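(* Let $n\ge1$ and $r\ge0$ be integers, and let $G$ be the graph on the vertex set $[n+2]$ whose edge multiset consists of $r+1$ edges $(1,2)$, $r$ edges $(1,i)$ for each $i\in\{3,4,\ldots,n+2\}$, and one edge $(i-1,i)$ for each $i\in\{3,4,\ldots,n+2\}$. Then $$\operatorname{vol}\mathcal{F}_{\tilde G}=\frac{1}{(r+1)(n+1)+1}\binom{(r+2)(n+1)}{n+1}.$$
   Context: Graphs may have multiple edges (distinct parallel edges are different elements of the edge multiset); vertex sets are totally ordered; an edge is written $(i,j)$ with $i<j$, $i$ being its initial and $j$ its final vertex. $[N]=\{1,\dots,N\}$. For $G=([N],E)$, $\tilde G$ is the graph on $[N]\cup\{s,t\}$, with $s$ smaller and $t$ larger than all of $[N]$, and edge multiset $E\cup\{(s,i),(i,t): i\in[N]\}$. The flow polytope $\mathcal{F}_H$ of a graph $H$ with smallest vertex $s$ and largest vertex $t$ is the set of functions $f:E(H)\to\mathbb{R}_{\ge0}$ such that the total $f$-value of edges with initial vertex $s$ is $1$, the total $f$-value of edges with final vertex $t$ is $1$, and at every other vertex the total incoming $f$-value equals the total outgoing $f$-value. $\operatorname{vol}$ is normalized volume (with respect to the integer lattice in the affine hull, a unimodular simplex having volume $1$). *)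

theory Defs
  imports
    "HOL-Analysis.Analysis"
    "HOL-Analysis.Finite_Function_Topology"
    "HOL-Library.Multiset"
    "Graph_Theory.Digraph"
begin

section \<open>Multigraphs given by an edge multiset\<close>

text \<open>
  An edge is a pair \<open>(i, j)\<close> directed from \<open>i\<close> to \<open>j\<close>. The \<open>m\<close> copies of an edge of multiplicity
  \<open>m\<close> are the distinct arcs \<open>((i, j), 0), \<dots>, ((i, j), m - 1)\<close>.
\<close>

definition multigraph :: "'v set \<Rightarrow> ('v \<times> 'v) multiset \<Rightarrow> ('v, ('v \<times> 'v) \<times> nat) pre_digraph" where
  "multigraph V E =
     \<lparr>verts = V, arcs = {(e, k). k < count E e}, tail = fst \<circ> fst, head = snd \<circ> fst\<rparr>"

text \<open>
  For a graph on \<open>{1..N}\<close> with edge multiset \<open>E\<close>; the new vertices \<open>s\<close> and \<open>t\<close> are \<open>0\<close> and \<open>N + 1\<close>.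
\<close>

definition tilde_graph :: "nat \<Rightarrow> (nat \<times> nat) multiset \<Rightarrow> (nat, (nat \<times> nat) \<times> nat) pre_digraph" where
  "tilde_graph N E =
     multigraph ({0} \<union> {1..N} \<union> {N + 1}) (E + (\<Sum>i\<in>{1..N}. {#(0, i), (i, N + 1)#}))"

section \<open>Flow polytopes\<close>

text \<open>
  Functions on the arcs are represented by finitely supported functions vanishing outside the arc
  set, so that the library's real vector space structure (and hence \<open>affine hull\<close>) is available.
  The graph is assumed to be finite.
\<close>

definition flow_polytope :: "('v::linorder, 'e) pre_digraph \<Rightarrow> ('e \<Rightarrow>\<^sub>0 real) set" where
  "flow_polytope H = (let s = Min (verts H); t = Max (verts H) in
     {f. Poly_Mapping.keys f \<subseteq> arcs H \<and>
         (\<forall>e\<in>arcs H. 0 \<le> Poly_Mapping.lookup f e) \<and>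
         (\<Sum>e\<in>out_arcs H s. Poly_Mapping.lookup f e) = 1 \<and>
         (\<Sum>e\<in>in_arcs H t. Poly_Mapping.lookup f e) = 1 \<and>
         (\<forall>v\<in>verts H - {s, t}.
            (\<Sum>e\<in>in_arcs H v. Poly_Mapping.lookup f e) =
            (\<Sum>e\<in>out_arcs H v. Poly_Mapping.lookup f e))})"

section \<open>Normalized volume\<close>

definition integer_points :: "('e \<Rightarrow>\<^sub>0 real) set" where
  "integer_points = {x. \<forall>e. Poly_Mapping.lookup x e \<in> \<int>}"

text \<open>
  A frame \<open>(d, p, b)\<close> is an affine coordinate system of the affine hull of \<open>P\<close> in which the points
  with integer coordinates are exactly the integer points of the affine hull.
\<close>

definition is_lattice_frame ::
  "('e \<Rightarrow>\<^sub>0 real) set \<Rightarrow> nat \<times> ('e \<Rightarrow>\<^sub>0 real) \<times> (nat \<Rightarrow> 'e \<Rightarrow>\<^sub>0 real) \<Rightarrow> bool" where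
  "is_lattice_frame P = (\<lambda>(d, p, b).
     inj_on b {..<d} \<and> independent (b ` {..<d}) \<and>
     affine hull P = range (\<lambda>c :: nat \<Rightarrow> real. p + (\<Sum>i<d. c i *\<^sub>R b i)) \<and>
     affine hull P \<inter> integer_points = range (\<lambda>c :: nat \<Rightarrow> int. p + (\<Sum>i<d. of_int (c i) *\<^sub>R b i)))"

text \<open>
  Two frames of \<open>P\<close> differ by an affine unimodular change of coordinates, so the value does not depend
  on the choice. The factor \<open>fact d\<close> gives unimodular simplices volume \<open>1\<close>. The value is
  meaningful only if a frame exists, as it does for a nonempty polytope with integral vertices.
\<close>

definition normalized_volume :: "('e \<Rightarrow>\<^sub>0 real) set \<Rightarrow> real" where
  "normalized_volume P = (let (d, p, b) = (SOME F. is_lattice_frame P F) in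
     fact d * measure (\<Pi>\<^sub>M i\<in>{..<d}. lborel)
       {c \<in> {..<d} \<rightarrow>\<^sub>E UNIV. p + (\<Sum>i<d. c i *\<^sub>R b i) \<in> P})"

section \<open>The graph under consideration\<close>

definition G_edges :: "nat \<Rightarrow> nat \<Rightarrow> (nat \<times> nat) multiset" where
  "G_edges n r =
     replicate_mset (r + 1) (1, 2) +
     (\<Sum>i\<in>{3..n + 2}. replicate_mset r (1, i)) +
     (\<Sum>i\<in>{3..n + 2}. {#(i - 1, i)#})"

end

theory Submission
  imports Defs
begin

text \<open>
  The flow polytope is, up to a lattice-preserving change of coordinates, the order polytope of a
  poset whose linear extensions are ballot sequences; that is where the Fuss--Catalan number comes
  from.

  Write \<open>m = n + 1\<close> and \<open>q = r + 1\<close>, and let \<open>u = 0, \<dots>, m - 1\<close> number the vertices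
  \<open>n + 2, n + 1, \<dots>, 2\<close> from the largest downwards. Each of these vertices receives \<open>q\<close> interchangeable
  amounts of flow: one from \<open>s\<close> and \<open>r\<close> along the parallel edges from vertex 1. It also receives flow
  along the path edge from its predecessor. List the \<open>q * m\<close> interchangeable amounts vertex by vertex
  and let \<open>s_1, s_2, \<dots>\<close> be their partial sums; let \<open>a_1, \<dots>, a_m\<close> be the partial sums of the flow
  sent to \<open>t\<close>, in the same order of the vertices. Together with 0 and 1, these numbers
  have the flow on every edge among their differences, except for the edge from \<open>s\<close> to vertex 1,
  whose flow the others determine. In particular, conservation of flow across the cut behind the
  first \<open>u + 1\<close> of these vertices says that the path edge into the last of them carries
  \<open>a_(u + 1) - s_(q (u + 1))\<close>. Nonnegativity therefore means
  \<open>0 \<le> s_1 \<le> s_2 \<le> \<dots>\<close>, \<open>0 \<le> a_1 \<le> \<dots> \<le> a_m \<le> 1\<close> and \<open>s_(q u) \<le> a_u\<close> for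
  \<open>u = 1, \<dots>, m\<close>
  (\<open>arc_value_nonneg_iff\<close>). Partial sums and differences are both integral, so these coordinates
  form a lattice frame (\<open>lattice_frame_flow_polytope\<close>).

  The volume of the region cut out by these inequalities is found by recursion over its largest
  coordinate, which is the last element of one of the two chains. With \<open>i\<close> numbers in the
  first chain, \<open>j\<close> in the second and upper bound \<open>x\<close>, the recursion is that of ballot sequences, and it
  is solved by \<open>(i + 1 - q j) x^(i + j) / ((i + 1)! j!)\<close> (\<open>emeasure_two_chain_region\<close>). The case
  \<open>i = q m\<close>, \<open>j = m\<close>, \<open>x = 1\<close>, multiplied by \<open>(q m + m)!\<close>, is the number wanted.

  The normalized volume refers to an arbitrary lattice frame, so one also needs that all frames give
  the same value (\<open>normalized_volume_eq\<close>). Two frames differ by an affine bijection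
  whose linear part permutes the integer vectors. It preserves volume: Lebesgue measure gives every
  fundamental domain of the integer lattice measure 1, the bijection carries fundamental domains to
  fundamental domains, and Fubini's theorem transfers this from fundamental domains to all
  measurable sets (\<open>emeasure_lattice_preserving_vimage\<close>).
\<close>

section \<open>Lattice-preserving maps preserve Lebesgue measure\<close>

abbreviation lborel_on :: "nat set \<Rightarrow> (nat \<Rightarrow> real) measure" where
  "lborel_on I \<equiv> \<Pi>\<^sub>M i\<in>I. lborel"

abbreviation lborel_pow :: "nat \<Rightarrow> (nat \<Rightarrow> real) measure" where
  "lborel_pow d \<equiv> lborel_on {..<d}"

interpretation lborel_product: product_sigma_finite "\<lambda>_ :: nat. lborel :: real measure"
  by standard

lemma sigma_finite_lborel_pow: "sigma_finite_measure (lborel_pow d)"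
  by (rule lborel_product.sigma_finite) simp

interpretation lborel_pow_pair: pair_sigma_finite "lborel_pow d" "lborel_pow d'" for d d'
  by (intro pair_sigma_finite.intro sigma_finite_lborel_pow)

text \<open>
  Elements of the product space are \<open>undefined\<close> outside \<open>{..<d}\<close>, so pointwise addition has to be
  restricted in order to stay in the space.
\<close>

definition vadd :: "nat \<Rightarrow> (nat \<Rightarrow> real) \<Rightarrow> (nat \<Rightarrow> real) \<Rightarrow> nat \<Rightarrow> real" where
  "vadd d x y = (\<lambda>i\<in>{..<d}. x i + y i)"

definition vsub :: "nat \<Rightarrow> (nat \<Rightarrow> real) \<Rightarrow> (nat \<Rightarrow> real) \<Rightarrow> nat \<Rightarrow> real" where
  "vsub d x y = (\<lambda>i\<in>{..<d}. x i - y i)"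

lemma vadd_space [simp]: "vadd d x y \<in> space (lborel_pow d)"
  by (auto simp: vadd_def space_PiM)

lemma space_lborel_pow: "space (lborel_pow d) = ({..<d} \<rightarrow>\<^sub>E UNIV)"
  by (simp add: space_PiM)

lemma measurable_lborel_pow_component:
  assumes "f \<in> measurable M (lborel_pow d)" "i \<in> {..<d}"
  shows "(\<lambda>x. f x i) \<in> borel_measurable M"
  using measurable_compose[OF assms(1) measurable_component_singleton[OF assms(2)]] by simp

lemma measurable_vadd [measurable]:
  assumes "f \<in> measurable M (lborel_pow d)" "g \<in> measurable M (lborel_pow d)"
  shows "(\<lambda>x. vadd d (f x) (g x)) \<in> measurable M (lborel_pow d)"
  unfolding vadd_def
  using borel_measurable_add[OF measurable_lborel_pow_component[OF assms(1)]
      measurable_lborel_pow_component[OF assms(2)]]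
  by (intro measurable_restrict) simp

lemma measurable_vsub [measurable]:
  assumes "f \<in> measurable M (lborel_pow d)" "g \<in> measurable M (lborel_pow d)"
  shows "(\<lambda>x. vsub d (f x) (g x)) \<in> measurable M (lborel_pow d)"
  unfolding vsub_def
  using borel_measurable_diff[OF measurable_lborel_pow_component[OF assms(1)]
      measurable_lborel_pow_component[OF assms(2)]]
  by (intro measurable_restrict) simp

lemma measurable_translation [measurable]:
  "(\<lambda>x. vadd d x y) \<in> measurable (lborel_pow d) (lborel_pow d)"
  unfolding vadd_def by (rule measurable_restrict) measurable

lemma distr_lborel_pow_vadd: "distr (lborel_pow d) (lborel_pow d) (\<lambda>x. vadd d x y) = lborel_pow d"
proof (rule lborel_product.PiM_eqI)
  fix A :: "nat \<Rightarrow> real set" assume A: "\<And>i. i \<in> {..<d} \<Longrightarrow> A i \<in> sets lborel"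
  have meas: "(\<lambda>t. t + y i) -` A i \<in> sets lborel" if "i \<in> {..<d}" for i
  proof -
    have "(\<lambda>t. t + y i) -` A i \<inter> space lborel \<in> sets lborel"
      by (rule measurable_sets[OF _ A[OF that]]) measurable
    then show ?thesis by simp
  qed
  have "emeasure (distr (lborel_pow d) (lborel_pow d) (\<lambda>x. vadd d x y)) (Pi\<^sub>E {..<d} A) =
      emeasure (lborel_pow d) ((\<lambda>x. vadd d x y) -` Pi\<^sub>E {..<d} A \<inter> space (lborel_pow d))"
    by (rule emeasure_distr) (use A in \<open>auto intro!: sets_PiM_I_finite\<close>)
  also have "(\<lambda>x. vadd d x y) -` Pi\<^sub>E {..<d} A \<inter> space (lborel_pow d) =
      Pi\<^sub>E {..<d} (\<lambda>i. (\<lambda>t. t + y i) -` A i)"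
    by (auto simp: vadd_def space_PiM PiE_iff)
  also have "emeasure (lborel_pow d) \<dots> = (\<Prod>i<d. emeasure lborel ((\<lambda>t. t + y i) -` A i))"
    by (rule lborel_product.emeasure_PiM) (use meas in auto)
  also have "\<dots> = (\<Prod>i<d. emeasure lborel (A i))"
  proof (rule prod.cong)
    fix i assume "i \<in> {..<d}"
    have "emeasure lborel (A i) = emeasure (distr lborel borel ((+) (y i))) (A i)"
      by (simp add: lborel_distr_plus)
    also have "\<dots> = emeasure lborel ((+) (y i) -` A i \<inter> space lborel)"
      using A[OF \<open>i \<in> _\<close>] by (intro emeasure_distr) auto
    also have "(+) (y i) -` A i \<inter> space lborel = (\<lambda>t. t + y i) -` A i"
      by (auto simp: add.commute)
    finally show "emeasure lborel ((\<lambda>t. t + y i) -` A i) = emeasure lborel (A i)" ..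
  qed simp
  finally show "emeasure (distr (lborel_pow d) (lborel_pow d) (\<lambda>x. vadd d x y)) (Pi\<^sub>E {..<d} A) =
      (\<Prod>i<d. emeasure lborel (A i))" .
qed auto

lemma nn_integral_vadd:
  assumes "f \<in> borel_measurable (lborel_pow d)"
  shows "(\<integral>\<^sup>+x. f (vadd d x y) \<partial>lborel_pow d) = (\<integral>\<^sup>+x. f x \<partial>lborel_pow d)"
  using nn_integral_distr[OF measurable_translation, of f] assms by (simp add: distr_lborel_pow_vadd)

text \<open>
  Integer vectors are kept as real-valued functions, so that they can be added to points.
\<close>

definition int_vecs :: "nat \<Rightarrow> (nat \<Rightarrow> real) set" where
  "int_vecs d = ({..<d} \<rightarrow>\<^sub>E \<int>)"

definition unit_cube :: "nat \<Rightarrow> (nat \<Rightarrow> real) set" where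
  "unit_cube d = ({..<d} \<rightarrow>\<^sub>E {0..<1})"

lemma countable_int_vecs: "countable (int_vecs d)"
  unfolding int_vecs_def by (rule countable_PiE) (auto simp: Ints_def)

lemma measurable_unit_cube [measurable]: "unit_cube d \<in> sets (lborel_pow d)"
  unfolding unit_cube_def by (rule sets_PiM_I_finite) auto

lemma emeasure_unit_cube: "emeasure (lborel_pow d) (unit_cube d) = 1"
  unfolding unit_cube_def by (subst lborel_product.emeasure_PiM) auto

lemma unit_cube_fundamental:
  assumes "x \<in> space (lborel_pow d)"
  shows "\<exists>!k. k \<in> int_vecs d \<and> vadd d x k \<in> unit_cube d"
proof (rule ex1I)
  show "(\<lambda>i\<in>{..<d}. - of_int \<lfloor>x i\<rfloor>) \<in> int_vecs d \<and>
      vadd d x (\<lambda>i\<in>{..<d}. - of_int \<lfloor>x i\<rfloor>) \<in> unit_cube d"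
    by (auto simp: int_vecs_def unit_cube_def vadd_def) linarith
next
  fix k assume k: "k \<in> int_vecs d \<and> vadd d x k \<in> unit_cube d"
  have "k i = - of_int \<lfloor>x i\<rfloor>" if "i < d" for i
  proof -
    have "k i \<in> \<int>" "x i + k i \<in> {0..<1}"
      using k that by (auto simp: int_vecs_def unit_cube_def vadd_def PiE_iff)
    then obtain z where "k i = of_int z" by (auto elim: Ints_cases)
    then have "\<lfloor>x i\<rfloor> = -z"
      using \<open>x i + k i \<in> {0..<1}\<close> by (intro floor_unique) auto
    then show ?thesis using \<open>k i = _\<close> by simp
  qed
  then show "k = (\<lambda>i\<in>{..<d}. - of_int \<lfloor>x i\<rfloor>)"
    using k by (auto simp: int_vecs_def PiE_iff extensional_def fun_eq_iff)
qed

text \<open>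
  Two fundamental domains are equidecomposable by lattice translations: the part of \<open>F\<close> lying in the
  translate of the unit cube by \<open>- k\<close> is moved into the unit cube by \<open>k\<close>. The sum over all \<open>k\<close>
  counts every point of \<open>F\<close> once, and also every point of the cube once.
\<close>

lemma emeasure_fundamental_domain:
  assumes F [measurable]: "F \<in> sets (lborel_pow d)"
    and fund: "\<And>x. x \<in> space (lborel_pow d) \<Longrightarrow> \<exists>!k. k \<in> int_vecs d \<and> vadd d x k \<in> F"
  shows "emeasure (lborel_pow d) F = 1"
proof -
  let ?M = "lborel_pow d" and ?Z = "int_vecs d"
  let ?neg = "\<lambda>k :: nat \<Rightarrow> real. \<lambda>i\<in>{..<d}. - k i"
  have one: "(\<integral>\<^sup>+k. indicator E (vadd d x k) \<partial>count_space ?Z) = (1 :: ennreal)"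
    if ex: "\<exists>!k. k \<in> ?Z \<and> vadd d x k \<in> E" for E x
  proof -
    obtain k0 where k0: "k0 \<in> ?Z" "vadd d x k0 \<in> E"
      "\<And>k. k \<in> ?Z \<Longrightarrow> vadd d x k \<in> E \<Longrightarrow> k = k0" using ex by blast
    have "(\<integral>\<^sup>+k. indicator E (vadd d x k) \<partial>count_space ?Z) =
        (\<integral>\<^sup>+k. indicator {k0} k \<partial>count_space ?Z)"
    proof (rule nn_integral_cong)
      fix k assume "k \<in> space (count_space ?Z)"
      then have "vadd d x k \<in> E \<longleftrightarrow> k = k0" using k0 by (metis space_count_space)
      then show "indicator E (vadd d x k) = (indicator {k0} k :: ennreal)" by (simp add: indicator_def)
    qed
    also have "\<dots> = 1" using k0(1) by simp
    finally show ?thesis .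
  qed
  have cancel: "vadd d (vadd d x k) (?neg k) = x" if "x \<in> space ?M" for x k
    using that by (auto simp: vadd_def space_PiM PiE_iff extensional_def fun_eq_iff)
  have negZ: "bij_betw ?neg ?Z ?Z"
    by (rule bij_betwI[where g = ?neg])
      (auto simp: int_vecs_def PiE_iff extensional_def fun_eq_iff)
  have "emeasure ?M F = (\<integral>\<^sup>+x. indicator F x \<partial>?M)" by simp
  also have "\<dots> = (\<integral>\<^sup>+x. indicator F x * (\<integral>\<^sup>+k. indicator (unit_cube d) (vadd d x k) \<partial>count_space ?Z) \<partial>?M)"
    by (intro nn_integral_cong) (simp add: one[OF unit_cube_fundamental])
  also have "\<dots> = (\<integral>\<^sup>+x. (\<integral>\<^sup>+k. indicator F x * indicator (unit_cube d) (vadd d x k) \<partial>count_space ?Z) \<partial>?M)"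
    by (intro nn_integral_cong nn_integral_cmult[symmetric]) auto
  also have "\<dots> = (\<integral>\<^sup>+k. (\<integral>\<^sup>+x. indicator F x * indicator (unit_cube d) (vadd d x k) \<partial>?M) \<partial>count_space ?Z)"
    by (rule nn_integral_count_space_nn_integral[OF countable_int_vecs]) measurable
  \<comment> \<open>Translation invariance, applied for each lattice vector separately.\<close>
  also have "\<dots> = (\<integral>\<^sup>+k. (\<integral>\<^sup>+x. indicator F (vadd d x (?neg k)) * indicator (unit_cube d) x \<partial>?M) \<partial>count_space ?Z)"
  proof (rule nn_integral_cong)
    fix k
    have "(\<integral>\<^sup>+x. indicator F x * indicator (unit_cube d) (vadd d x k) \<partial>?M) =
      (\<integral>\<^sup>+x. indicator F (vadd d (vadd d x k) (?neg k)) * indicator (unit_cube d) (vadd d x k) \<partial>?M)"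
      by (intro nn_integral_cong) (simp only: cancel)
    also have "\<dots> = (\<integral>\<^sup>+x. indicator F (vadd d x (?neg k)) * indicator (unit_cube d) x \<partial>?M)"
      by (rule nn_integral_vadd) measurable
    finally show "(\<integral>\<^sup>+x. indicator F x * indicator (unit_cube d) (vadd d x k) \<partial>?M) =
      (\<integral>\<^sup>+x. indicator F (vadd d x (?neg k)) * indicator (unit_cube d) x \<partial>?M :: ennreal)" .
  qed
  also have "\<dots> = (\<integral>\<^sup>+x. (\<integral>\<^sup>+k. indicator F (vadd d x (?neg k)) * indicator (unit_cube d) x \<partial>count_space ?Z) \<partial>?M)"
    by (rule nn_integral_count_space_nn_integral[OF countable_int_vecs, symmetric]) measurable
  also have "\<dots> = (\<integral>\<^sup>+x. (\<integral>\<^sup>+k. indicator F (vadd d x (?neg k)) \<partial>count_space ?Z) * indicator (unit_cube d) x \<partial>?M)"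
    by (intro nn_integral_cong nn_integral_multc) auto
  also have "\<dots> = (\<integral>\<^sup>+x. (\<integral>\<^sup>+k. indicator F (vadd d x k) \<partial>count_space ?Z) * indicator (unit_cube d) x \<partial>?M)"
    by (intro nn_integral_cong arg_cong2[where f = "(*)"] refl
         nn_integral_bij_count_space[OF negZ, where f = "\<lambda>k. indicator F (vadd d _ k)"])
  also have "\<dots> = (\<integral>\<^sup>+x. indicator (unit_cube d) x \<partial>?M)"
    by (intro nn_integral_cong) (simp add: one[OF fund])
  also have "\<dots> = 1" by (simp add: emeasure_unit_cube)
  finally show ?thesis .
qed

text \<open>
  The vector \<open>L y\<close> is the displacement of \<open>T x\<close> when \<open>x\<close> is displaced by \<open>y\<close>. As \<open>L\<close> is onto, the measure of the
  preimage of \<open>B\<close> does not change when \<open>B\<close> is translated, so it may be averaged over translations by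
  the points of the unit cube. After exchanging the integrals, each \<open>z\<close> in \<open>B\<close> is
  weighted with the measure of the points \<open>c\<close> for which \<open>z - T c\<close> lies in the cube. These \<open>c\<close>
  form a fundamental domain, because \<open>L\<close> permutes the lattice, so all weights are 1.
\<close>

lemma emeasure_lattice_preserving_vimage:
  assumes T [measurable]: "T \<in> measurable (lborel_pow d) (lborel_pow d)"
    and L: "L ` space (lborel_pow d) = space (lborel_pow d)"
    and LZ: "bij_betw L (int_vecs d) (int_vecs d)"
    and T_add: "\<And>x y. x \<in> space (lborel_pow d) \<Longrightarrow> y \<in> space (lborel_pow d) \<Longrightarrow>
      T (vadd d x y) = vadd d (T x) (L y)"
    and B [measurable]: "B \<in> sets (lborel_pow d)"
  shows "emeasure (lborel_pow d) (T -` B \<inter> space (lborel_pow d)) = emeasure (lborel_pow d) B"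
proof -
  let ?M = "lborel_pow d" and ?Z = "int_vecs d" and ?Q = "unit_cube d"
  have Z_space: "?Z \<subseteq> space ?M" by (auto simp: int_vecs_def space_PiM)
  have T_space: "T x \<in> space ?M" if "x \<in> space ?M" for x
    using measurable_space[OF T that] .
  have [measurable]: "(\<lambda>c. vadd d (T c) x) \<in> measurable ?M ?M" for x
    by (rule measurable_compose[OF T measurable_translation])
  have inner: "(\<integral>\<^sup>+c. indicator B (T c) \<partial>?M) = (\<integral>\<^sup>+c. indicator B (vadd d (T c) x) \<partial>?M)"
    if x: "x \<in> space ?M" for x
  proof -
    obtain y where y: "y \<in> space ?M" "x = L y" using L x by blast
    have "(\<integral>\<^sup>+c. indicator B (T c) \<partial>?M) = (\<integral>\<^sup>+c. indicator B (T (vadd d c y)) \<partial>?M)"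
      by (rule nn_integral_vadd[symmetric]) measurable
    also have "\<dots> = (\<integral>\<^sup>+c. indicator B (vadd d (T c) x) \<partial>?M)"
      using y by (intro nn_integral_cong) (simp add: T_add)
    finally show ?thesis .
  qed
  have domain: "emeasure ?M {c \<in> space ?M. vsub d z (T c) \<in> ?Q} = 1" if z: "z \<in> space ?M" for z
  proof (rule emeasure_fundamental_domain)
    have "z \<in> space ?M" by fact
    then show "{c \<in> space ?M. vsub d z (T c) \<in> ?Q} \<in> sets ?M" by measurable
  next
    fix x assume x: "x \<in> space ?M"
    have "vsub d z (T x) \<in> space ?M" by (auto simp: space_PiM vsub_def)
    from unit_cube_fundamental[OF this]
    have ex: "\<exists>!k. k \<in> ?Z \<and> vadd d (vsub d z (T x)) k \<in> ?Q" .
    define K where "K = (\<lambda>k. \<lambda>i\<in>{..<d}. - L k i)"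
    have bij: "bij_betw K ?Z ?Z"
    proof -
      have "bij_betw (\<lambda>k :: nat \<Rightarrow> real. \<lambda>i\<in>{..<d}. - k i) ?Z ?Z"
        by (rule bij_betwI[where g = "\<lambda>k. \<lambda>i\<in>{..<d}. - k i"])
          (auto simp: int_vecs_def PiE_iff extensional_def fun_eq_iff)
      from bij_betw_trans[OF LZ this] show ?thesis by (simp add: o_def K_def)
    qed
    have eq: "vadd d (vsub d z (T x)) (K k) = vsub d z (T (vadd d x k))" if "k \<in> ?Z" for k
      using T_add[OF x, of k] subsetD[OF Z_space that]
      by (auto simp: vadd_def vsub_def K_def fun_eq_iff)
    have iff: "vadd d x k \<in> {c \<in> space ?M. vsub d z (T c) \<in> ?Q} \<longleftrightarrow>
        vadd d (vsub d z (T x)) (K k) \<in> ?Q" if "k \<in> ?Z" for k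
      by (simp only: eq[OF that]) simp
    from ex obtain k0 where k0: "k0 \<in> ?Z" "vadd d (vsub d z (T x)) k0 \<in> ?Q"
      and u: "\<And>k. k \<in> ?Z \<Longrightarrow> vadd d (vsub d z (T x)) k \<in> ?Q \<Longrightarrow> k = k0" by blast
    have "k0 \<in> K ` ?Z"
      using bij_betw_imp_surj_on[OF bij] k0(1) by simp
    then obtain k1 where k1: "k1 \<in> ?Z" "K k1 = k0" by auto
    show "\<exists>!k. k \<in> ?Z \<and> vadd d x k \<in> {c \<in> space ?M. vsub d z (T c) \<in> ?Q}"
    proof (rule ex1I[of _ k1])
      show "k1 \<in> ?Z \<and> vadd d x k1 \<in> {c \<in> space ?M. vsub d z (T c) \<in> ?Q}"
        using k1 k0 iff[of k1] by simp
      fix k assume k: "k \<in> ?Z \<and> vadd d x k \<in> {c \<in> space ?M. vsub d z (T c) \<in> ?Q}"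
      have "K k = k0"
        by (rule u[OF bij_betw_apply[OF bij] iffD1[OF iff]]) (use k in blast)+
      then show "k = k1"
        using inj_onD[OF bij_betw_imp_inj_on[OF bij], of k k1] k k1 by simp
    qed
  qed
  have "emeasure ?M (T -` B \<inter> space ?M) = (\<integral>\<^sup>+c. indicator B (T c) \<partial>?M)"
  proof -
    have "emeasure ?M (T -` B \<inter> space ?M) = (\<integral>\<^sup>+c. indicator (T -` B \<inter> space ?M) c \<partial>?M)"
      by (rule nn_integral_indicator[OF measurable_sets[OF T B], symmetric])
    also have "\<dots> = (\<integral>\<^sup>+c. indicator B (T c) \<partial>?M)"
      by (rule nn_integral_cong) (simp add: indicator_def)
    finally show ?thesis .
  qed
  also have "\<dots> = (\<integral>\<^sup>+x. indicator ?Q x * (\<integral>\<^sup>+c. indicator B (T c) \<partial>?M) \<partial>?M)"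
  proof -
    have "(\<integral>\<^sup>+x. indicator ?Q x * C \<partial>?M) = (\<integral>\<^sup>+x. indicator ?Q x \<partial>?M) * C" for C
      by (rule nn_integral_multc) simp
    then show ?thesis by (simp add: emeasure_unit_cube)
  qed
  also have "\<dots> = (\<integral>\<^sup>+x. indicator ?Q x * (\<integral>\<^sup>+c. indicator B (vadd d (T c) x) \<partial>?M) \<partial>?M)"
    by (intro nn_integral_cong) (simp only: inner)
  also have "\<dots> = (\<integral>\<^sup>+x. (\<integral>\<^sup>+c. indicator ?Q x * indicator B (vadd d (T c) x) \<partial>?M) \<partial>?M)"
    by (intro nn_integral_cong nn_integral_cmult[symmetric]) measurable
  also have "\<dots> = (\<integral>\<^sup>+c. (\<integral>\<^sup>+x. indicator ?Q x * indicator B (vadd d (T c) x) \<partial>?M) \<partial>?M)"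
    by (rule lborel_pow_pair.Fubini') measurable
  also have "\<dots> = (\<integral>\<^sup>+c. (\<integral>\<^sup>+z. indicator ?Q (vsub d z (T c)) * indicator B z \<partial>?M) \<partial>?M)"
  proof (rule nn_integral_cong)
    fix c assume c: "c \<in> space ?M"
    have t[measurable]: "T c \<in> space ?M" by (rule T_space[OF c])
    have "(\<integral>\<^sup>+x. indicator ?Q x * indicator B (vadd d (T c) x) \<partial>?M) =
      (\<integral>\<^sup>+x. indicator ?Q (vsub d (vadd d x (T c)) (T c)) * indicator B (vadd d x (T c)) \<partial>?M)"
    proof (intro nn_integral_cong)
      fix x assume "x \<in> space ?M"
      then have "vsub d (vadd d x (T c)) (T c) = x" "vadd d x (T c) = vadd d (T c) x"
        by (auto simp: vadd_def vsub_def space_PiM PiE_iff extensional_def fun_eq_iff add.commute)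
      then show "indicator ?Q x * indicator B (vadd d (T c) x) =
        (indicator ?Q (vsub d (vadd d x (T c)) (T c)) * indicator B (vadd d x (T c)) :: ennreal)" by simp
    qed
    also have "\<dots> = (\<integral>\<^sup>+z. indicator ?Q (vsub d z (T c)) * indicator B z \<partial>?M)"
      by (rule nn_integral_vadd) measurable
    finally show "(\<integral>\<^sup>+x. indicator ?Q x * indicator B (vadd d (T c) x) \<partial>?M) =
      (\<integral>\<^sup>+z. indicator ?Q (vsub d z (T c)) * indicator B z \<partial>?M :: ennreal)" .
  qed
  also have "\<dots> = (\<integral>\<^sup>+z. (\<integral>\<^sup>+c. indicator ?Q (vsub d z (T c)) * indicator B z \<partial>?M) \<partial>?M)"
    by (rule lborel_pow_pair.Fubini') measurable
  also have "\<dots> = (\<integral>\<^sup>+z. indicator B z \<partial>?M)"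
  proof (rule nn_integral_cong)
    fix z assume z: "z \<in> space ?M"
    then have [measurable]: "{c \<in> space ?M. vsub d z (T c) \<in> ?Q} \<in> sets ?M" by measurable
    have "(\<integral>\<^sup>+c. indicator ?Q (vsub d z (T c)) * indicator B z \<partial>?M) =
      (\<integral>\<^sup>+c. indicator {c \<in> space ?M. vsub d z (T c) \<in> ?Q} c * indicator B z \<partial>?M)"
      by (intro nn_integral_cong) (auto simp: indicator_def)
    also have "\<dots> = indicator B z"
    proof -
      have "(\<integral>\<^sup>+c. indicator {c \<in> space ?M. vsub d z (T c) \<in> ?Q} c * indicator B z \<partial>?M) =
        (\<integral>\<^sup>+c. indicator {c \<in> space ?M. vsub d z (T c) \<in> ?Q} c \<partial>?M) * (indicator B z :: ennreal)"
        by (rule nn_integral_multc) simp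
      then show ?thesis by (simp add: domain[OF z])
    qed
    finally show "(\<integral>\<^sup>+c. indicator ?Q (vsub d z (T c)) * indicator B z \<partial>?M) = (indicator B z :: ennreal)" .
  qed
  also have "\<dots> = emeasure ?M B" by simp
  finally show ?thesis .
qed

section \<open>Lattice frames compute the normalized volume\<close>

definition lin_comb :: "nat \<Rightarrow> (nat \<Rightarrow> 'v::real_vector) \<Rightarrow> (nat \<Rightarrow> real) \<Rightarrow> 'v" where
  "lin_comb d b c = (\<Sum>i<d. c i *\<^sub>R b i)"

lemma lin_comb_eq_iff:
  fixes b :: "nat \<Rightarrow> 'v::real_vector"
  assumes inj: "inj_on b {..<d}" and ind: "independent (b ` {..<d})"
  shows "lin_comb d b c = lin_comb d b c' \<longleftrightarrow> (\<forall>i<d. c i = c' i)"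
proof
  assume eq: "lin_comb d b c = lin_comb d b c'"
  define u where "u = (\<lambda>v. c (inv_into {..<d} b v) - c' (inv_into {..<d} b v))"
  have u: "u (b i) = c i - c' i" if "i < d" for i
    using inj that by (simp add: u_def)
  have "(\<Sum>v\<in>b ` {..<d}. u v *\<^sub>R v) = (\<Sum>i<d. (c i - c' i) *\<^sub>R b i)"
    by (subst sum.reindex[OF inj]) (simp add: u)
  also have "\<dots> = 0"
    using eq by (simp add: lin_comb_def scaleR_diff_left sum_subtractf)
  finally have "u v = 0" if "v \<in> b ` {..<d}" for v
    using independentD[OF ind _ subset_refl, of u v] that by simp
  then show "\<forall>i<d. c i = c' i" using u by force
qed (auto simp: lin_comb_def)

lemma is_lattice_frameD:
  assumes "is_lattice_frame P (d, p, b)"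
  shows "inj_on b {..<d}" "independent (b ` {..<d})"
    "affine hull P = range (\<lambda>c. p + lin_comb d b c)"
    "affine hull P \<inter> integer_points = range (\<lambda>c :: nat \<Rightarrow> int. p + lin_comb d b (\<lambda>i. of_int (c i)))"
  using assms by (auto simp: is_lattice_frame_def lin_comb_def)

text \<open>
  The origin and the directions of one frame have integer coordinates in the other frame, because \<open>p\<close> and
  \<open>p + b j\<close> are integer points of the affine hull.
\<close>

lemma lattice_frame_transition:
  fixes P :: "('e \<Rightarrow>\<^sub>0 real) set"
  assumes F: "is_lattice_frame P (d, p, b)" and F': "is_lattice_frame P (d', p', b')"
  obtains \<tau> M where "p = p' + lin_comb d' b' \<tau>"
    "\<And>j. j < d \<Longrightarrow> b j = lin_comb d' b' (M j)"
    "\<And>j i. M j i \<in> \<int>"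
proof -
  have coord: "\<exists>z :: nat \<Rightarrow> int. x = p' + lin_comb d' b' (\<lambda>i. of_int (z i))"
    if "x \<in> affine hull P \<inter> integer_points" for x
    using that by (auto simp: is_lattice_frameD(4)[OF F'])
  have lattice: "p + lin_comb d b (\<lambda>i. of_int (z i)) \<in> affine hull P \<inter> integer_points"
    for z :: "nat \<Rightarrow> int"
    by (auto simp: is_lattice_frameD(4)[OF F])
  have "p \<in> affine hull P \<inter> integer_points"
    using lattice[of "\<lambda>_. 0"] by (simp add: lin_comb_def)
  from coord[OF this] obtain t where t: "p = p' + lin_comb d' b' (\<lambda>i. of_int (t i))" by blast
  have "\<exists>z :: nat \<Rightarrow> int. p + b j = p' + lin_comb d' b' (\<lambda>i. of_int (z i))" if "j < d" for j
  proof -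
    have "p + lin_comb d b (\<lambda>i. of_int (if i = j then 1 else 0)) = p + b j"
      using that by (simp add: lin_comb_def if_distrib[of of_int] if_distrib[of "\<lambda>x. x *\<^sub>R _"]
          sum.delta cong: if_cong)
    then show ?thesis using coord lattice by metis
  qed
  then obtain z :: "nat \<Rightarrow> nat \<Rightarrow> int"
    where z: "\<And>j. j < d \<Longrightarrow> p + b j = p' + lin_comb d' b' (\<lambda>i. of_int (z j i))" by metis
  show thesis
  proof
    show "p = p' + lin_comb d' b' (\<lambda>i. of_int (t i))" by (fact t)
    show "b j = lin_comb d' b' (\<lambda>i. of_int (z j i - t i))" if "j < d" for j
    proof -
      have "b j = lin_comb d' b' (\<lambda>i. of_int (z j i)) - lin_comb d' b' (\<lambda>i. of_int (t i))"
        using z[OF that] t by (simp add: algebra_simps)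
      then show ?thesis by (simp add: lin_comb_def scaleR_diff_left sum_subtractf)
    qed
    show "real_of_int (z j i - t i) \<in> \<int>" for j i by simp
  qed
qed

lemma lin_comb_transition:
  assumes "\<And>j. j < d \<Longrightarrow> b j = lin_comb d' b' (M j)"
  shows "lin_comb d b c = lin_comb d' b' (\<lambda>i. \<Sum>j<d. c j * M j i)"
proof -
  have "lin_comb d b c = (\<Sum>j<d. c j *\<^sub>R (\<Sum>i<d'. M j i *\<^sub>R b' i))"
    unfolding lin_comb_def[of d] using assms by (simp add: lin_comb_def)
  also have "\<dots> = (\<Sum>j<d. \<Sum>i<d'. (c j * M j i) *\<^sub>R b' i)"
    by (simp add: scaleR_sum_right)
  also have "\<dots> = (\<Sum>i<d'. \<Sum>j<d. (c j * M j i) *\<^sub>R b' i)"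
    by (rule sum.swap)
  finally show ?thesis by (simp add: lin_comb_def scaleR_sum_left)
qed

lemma lattice_frame_dim_le:
  fixes P :: "('e \<Rightarrow>\<^sub>0 real) set"
  assumes F: "is_lattice_frame P (d, p, b)" and F': "is_lattice_frame P (d', p', b')"
  shows "d \<le> d'"
proof -
  obtain M where M: "\<And>j. j < d \<Longrightarrow> b j = lin_comb d' b' (M j)"
    using lattice_frame_transition[OF F F'] by metis
  have "b ` {..<d} \<subseteq> span (b' ` {..<d'})"
  proof clarify
    fix j assume "j < d"
    show "b j \<in> span (b' ` {..<d'})"
      unfolding M[OF \<open>j < d\<close>] lin_comb_def by (intro span_sum span_scale span_base imageI)
  qed
  from independent_span_bound[OF _ is_lattice_frameD(2)[OF F] this]
  have "card (b ` {..<d}) \<le> card (b' ` {..<d'})" by simp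
  then show ?thesis
    using is_lattice_frameD(1)[OF F] is_lattice_frameD(1)[OF F'] by (simp add: card_image)
qed

text \<open>
  The change of coordinates \<open>T\<close> between the frames has the transition matrix as its linear part \<open>L\<close>. The
  transition matrix in the opposite direction is integral as well and inverts it, so \<open>L\<close> permutes
  the integer vectors.
\<close>

lemma emeasure_lattice_frame_cong:
  fixes P :: "('e \<Rightarrow>\<^sub>0 real) set"
  assumes F: "is_lattice_frame P (d, p, b)" and F': "is_lattice_frame P (d, p', b')"
    and meas: "{c \<in> {..<d} \<rightarrow>\<^sub>E UNIV. p' + lin_comb d b' c \<in> P} \<in> sets (lborel_pow d)"
  shows "emeasure (lborel_pow d) {c \<in> {..<d} \<rightarrow>\<^sub>E UNIV. p + lin_comb d b c \<in> P} =
    emeasure (lborel_pow d) {c \<in> {..<d} \<rightarrow>\<^sub>E UNIV. p' + lin_comb d b' c \<in> P}"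
proof -
  obtain \<tau> M where \<tau>: "p = p' + lin_comb d b' \<tau>"
    and M: "\<And>j. j < d \<Longrightarrow> b j = lin_comb d b' (M j)" and M_int: "\<And>j i. M j i \<in> \<int>"
    using lattice_frame_transition[OF F F'] by metis
  obtain M' where M': "\<And>j. j < d \<Longrightarrow> b' j = lin_comb d b (M' j)" and M'_int: "\<And>j i. M' j i \<in> \<int>"
    using lattice_frame_transition[OF F' F] by metis
  define L where "L = (\<lambda>y. \<lambda>i\<in>{..<d}. \<Sum>j<d. y j * M j i)"
  define L' where "L' = (\<lambda>y. \<lambda>i\<in>{..<d}. \<Sum>j<d. y j * M' j i)"
  define T where "T = (\<lambda>c. \<lambda>i\<in>{..<d}. \<tau> i + (\<Sum>j<d. c j * M j i))"
  have lin_L: "lin_comb d b' (L y) = lin_comb d b y" for y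
    using lin_comb_transition[of d b, OF M, of y] by (simp add: L_def lin_comb_def)
  have lin_L': "lin_comb d b (L' y) = lin_comb d b' y" for y
    using lin_comb_transition[of d b', OF M', of y] by (simp add: L'_def lin_comb_def)
  have lin_T: "p + lin_comb d b c = p' + lin_comb d b' (T c)" for c
  proof -
    have "p + lin_comb d b c = p' + (lin_comb d b' \<tau> + lin_comb d b' (L c))"
      by (simp add: lin_L \<tau> add.assoc)
    also have "lin_comb d b' \<tau> + lin_comb d b' (L c) = lin_comb d b' (T c)"
      by (simp add: lin_comb_def L_def T_def scaleR_add_left sum.distrib)
    finally show ?thesis .
  qed
  have ext: "f = g" if "f \<in> extensional {..<d}" "g \<in> extensional {..<d}" "\<forall>i<d. f i = g i"
    for f g :: "nat \<Rightarrow> real"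
    using that by (intro extensionalityI[of _ "{..<d}"]) auto
  have LL': "L (L' y) = y" if "y \<in> extensional {..<d}" for y
  proof (rule ext)
    have "lin_comb d b' (L (L' y)) = lin_comb d b' y" by (simp add: lin_L lin_L')
    then show "\<forall>i<d. L (L' y) i = y i"
      using lin_comb_eq_iff[OF is_lattice_frameD(1,2)[OF F']] by blast
  qed (use that in \<open>auto simp: L_def\<close>)
  have L'L: "L' (L y) = y" if "y \<in> extensional {..<d}" for y
  proof (rule ext)
    have "lin_comb d b (L' (L y)) = lin_comb d b y" by (simp add: lin_L lin_L')
    then show "\<forall>i<d. L' (L y) i = y i"
      using lin_comb_eq_iff[OF is_lattice_frameD(1,2)[OF F]] by blast
  qed (use that in \<open>auto simp: L'_def\<close>)
  have space: "space (lborel_pow d) = extensional {..<d}"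
    by (simp add: space_lborel_pow PiE_UNIV_domain PiE_def Pi_UNIV)
  have int_ext: "int_vecs d \<subseteq> extensional {..<d}" by (auto simp: int_vecs_def PiE_def)
  have emeas: "emeasure (lborel_pow d)
      (T -` {c \<in> {..<d} \<rightarrow>\<^sub>E UNIV. p' + lin_comb d b' c \<in> P} \<inter> space (lborel_pow d)) =
    emeasure (lborel_pow d) {c \<in> {..<d} \<rightarrow>\<^sub>E UNIV. p' + lin_comb d b' c \<in> P}"
  proof (rule emeasure_lattice_preserving_vimage[where L = L])
    show "T \<in> measurable (lborel_pow d) (lborel_pow d)"
      unfolding T_def by (rule measurable_restrict) simp
    have "L ` space (lborel_pow d) \<subseteq> space (lborel_pow d)" by (auto simp: L_def space)
    moreover have "y \<in> L ` space (lborel_pow d)" if "y \<in> space (lborel_pow d)" for y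
      using LL'[of y] that by (intro image_eqI[of _ _ "L' y"]) (auto simp: space L'_def)
    ultimately show "L ` space (lborel_pow d) = space (lborel_pow d)" by blast
    show "bij_betw L (int_vecs d) (int_vecs d)"
    proof (rule bij_betwI[where g = L'])
      show "L \<in> int_vecs d \<rightarrow> int_vecs d" "L' \<in> int_vecs d \<rightarrow> int_vecs d"
        using M_int M'_int by (auto simp: int_vecs_def L_def L'_def PiE_iff intro!: Ints_sum Ints_mult)
    qed (use int_ext LL' L'L in auto)
    show "T (vadd d x y) = vadd d (T x) (L y)" for x y
      by (auto simp: vadd_def T_def L_def fun_eq_iff distrib_right sum.distrib)
  qed (fact meas)
  have "{c \<in> {..<d} \<rightarrow>\<^sub>E UNIV. p + lin_comb d b c \<in> P} =
      T -` {c \<in> {..<d} \<rightarrow>\<^sub>E UNIV. p' + lin_comb d b' c \<in> P} \<inter> space (lborel_pow d)"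
    by (auto simp: lin_T space_lborel_pow T_def)
  then show ?thesis using emeas by simp
qed

text \<open>
  The Hilbert choice in the definition of normalized volume may be replaced by any convenient frame.
\<close>

theorem normalized_volume_eq:
  fixes P :: "('e \<Rightarrow>\<^sub>0 real) set"
  assumes F: "is_lattice_frame P (d, p, b)"
    and meas: "{c \<in> {..<d} \<rightarrow>\<^sub>E UNIV. p + lin_comb d b c \<in> P} \<in> sets (lborel_pow d)"
  shows "normalized_volume P =
    fact d * measure (lborel_pow d) {c \<in> {..<d} \<rightarrow>\<^sub>E UNIV. p + lin_comb d b c \<in> P}"
proof -
  obtain d' p' b' where F'_def: "(SOME F. is_lattice_frame P F) = (d', p', b')"
    by (rule prod_cases3)
  have F': "is_lattice_frame P (d', p', b')"
    using someI[of "is_lattice_frame P", OF F] by (simp add: F'_def)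
  have "d' = d"
    using lattice_frame_dim_le[OF F F'] lattice_frame_dim_le[OF F' F] by simp
  have "normalized_volume P =
      fact d * measure (lborel_pow d) {c \<in> {..<d} \<rightarrow>\<^sub>E UNIV. p' + lin_comb d b' c \<in> P}"
    by (simp add: normalized_volume_def F'_def \<open>d' = d\<close> lin_comb_def)
  also have "measure (lborel_pow d) {c \<in> {..<d} \<rightarrow>\<^sub>E UNIV. p' + lin_comb d b' c \<in> P} =
      measure (lborel_pow d) {c \<in> {..<d} \<rightarrow>\<^sub>E UNIV. p + lin_comb d b c \<in> P}"
    using emeasure_lattice_frame_cong[OF F'[unfolded \<open>d' = d\<close>] F meas] by (simp add: measure_def)
  finally show ?thesis .
qed

text \<open>
  A coordinate function \<open>\<Psi>\<close> that is integral on integer points settles independence of the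
  directions and the description of the integer points at the same time.
\<close>

lemma is_lattice_frameI:
  fixes P :: "('e \<Rightarrow>\<^sub>0 real) set" and \<Psi> :: "('e \<Rightarrow>\<^sub>0 real) \<Rightarrow> nat \<Rightarrow> real"
  assumes hull: "affine hull P = range (\<lambda>c. p + lin_comb d b c)"
    and left_inv: "\<And>c i. i < d \<Longrightarrow> \<Psi> (p + lin_comb d b c) i = c i"
    and int: "\<And>c :: nat \<Rightarrow> int. p + lin_comb d b (\<lambda>i. of_int (c i)) \<in> integer_points"
    and int_inv: "\<And>x i. x \<in> affine hull P \<Longrightarrow> x \<in> integer_points \<Longrightarrow> \<Psi> x i \<in> \<int>"
  shows "is_lattice_frame P (d, p, b)"
proof -
  have unit: "lin_comb d b (\<lambda>i. if i = j then 1 else 0) = b j" if "j < d" for j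
    using that by (simp add: lin_comb_def if_distrib[of "\<lambda>x. x *\<^sub>R _"] cong: if_cong)
  have inj: "inj_on b {..<d}"
  proof (rule inj_onI)
    fix i j assume "i \<in> {..<d}" "j \<in> {..<d}" "b i = b j"
    then have ij: "i < d" "j < d" by auto
    have "lin_comb d b (\<lambda>k. if k = i then 1 else 0) = lin_comb d b (\<lambda>k. if k = j then 1 else 0)"
      using \<open>b i = b j\<close> by (simp add: unit ij)
    then have "(if i = i then 1 else 0 :: real) = (if i = j then 1 else 0)"
      using left_inv[OF ij(1), of "\<lambda>k. if k = i then 1 else 0"]
        left_inv[OF ij(1), of "\<lambda>k. if k = j then 1 else 0"] by simp
    then show "i = j" by (simp split: if_splits)
  qed
  moreover have "independent (b ` {..<d})"
  proof (rule independent_if_scalars_zero)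
    fix u x assume "(\<Sum>x\<in>b ` {..<d}. u x *\<^sub>R x) = 0" "x \<in> b ` {..<d}"
    then obtain j where j: "j < d" "x = b j" by auto
    have "lin_comb d b (\<lambda>i. u (b i)) = lin_comb d b (\<lambda>i. 0)"
      using \<open>(\<Sum>x\<in>b ` {..<d}. u x *\<^sub>R x) = 0\<close> by (simp add: lin_comb_def sum.reindex[OF inj])
    then show "u x = 0"
      using left_inv[OF j(1), of "\<lambda>i. u (b i)"] left_inv[OF j(1), of "\<lambda>i. 0"] j(2) by simp
  qed simp
  moreover have "affine hull P \<inter> integer_points =
      range (\<lambda>c :: nat \<Rightarrow> int. p + lin_comb d b (\<lambda>i. of_int (c i)))"
  proof (intro equalityI subsetI)
    fix x assume x: "x \<in> affine hull P \<inter> integer_points"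
    then obtain c where c: "x = p + lin_comb d b c" by (auto simp: hull)
    have "c i = of_int \<lfloor>c i\<rfloor>" if "i < d" for i
      using int_inv[of x i] x left_inv[OF that, of c] c by (auto elim: Ints_cases)
    then have "x = p + lin_comb d b (\<lambda>i. of_int \<lfloor>c i\<rfloor>)"
      by (simp add: c lin_comb_def)
    then show "x \<in> range (\<lambda>c :: nat \<Rightarrow> int. p + lin_comb d b (\<lambda>i. of_int (c i)))"
      by (rule image_eqI[where x = "\<lambda>i. \<lfloor>c i\<rfloor>"]) simp
  qed (use int hull in auto)
  ultimately show ?thesis
    using hull by (simp add: is_lattice_frame_def lin_comb_def)
qed

section \<open>The volume of two interleaved chains\<close>

text \<open>
  Indices below \<open>i\<close> hold the lower chain, indices from \<open>M\<close> on the upper chain. All pairs of a chain are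
  compared, instead of neighbours only, so that the last element of a chain directly bounds the
  others.
\<close>

definition two_chains :: "nat \<Rightarrow> nat \<Rightarrow> nat \<Rightarrow> nat \<Rightarrow> real \<Rightarrow> (nat \<Rightarrow> real) \<Rightarrow> bool" where
  "two_chains q M i j x c \<longleftrightarrow>
     (\<forall>l<i. 0 \<le> c l \<and> c l \<le> x \<and> (\<forall>l'<l. c l' \<le> c l)) \<and>
     (\<forall>u<j. 0 \<le> c (M + u) \<and> c (M + u) \<le> x \<and> (\<forall>u'<u. c (M + u') \<le> c (M + u)) \<and>
        (\<forall>l<q * (u + 1). c l \<le> c (M + u)))"

text \<open>
  On a line in the direction of coordinate \<open>k\<close> there is exactly one point with a tie.
\<close>

lemma null_sets_tie:
  assumes I: "finite I" "k \<notin> I" "l \<in> I"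
  shows "{c \<in> space (lborel_on (insert k I)). c k = c l} \<in> null_sets (lborel_on (insert k I))"
proof -
  have [measurable]: "(\<lambda>c. c l) \<in> borel_measurable (lborel_on (insert k I))"
    "(\<lambda>c. c k) \<in> borel_measurable (lborel_on (insert k I))"
    using measurable_component_singleton[of l "insert k I" "\<lambda>_. lborel"]
      measurable_component_singleton[of k "insert k I" "\<lambda>_. lborel"] I by auto
  have m: "{c \<in> space (lborel_on (insert k I)). c k = c l} \<in> sets (lborel_on (insert k I))"
    by measurable
  have "emeasure (lborel_on (insert k I)) {c \<in> space (lborel_on (insert k I)). c k = c l} =
      (\<integral>\<^sup>+c. indicator {c \<in> space (lborel_on (insert k I)). c k = c l} c \<partial>lborel_on (insert k I))"
    by (rule nn_integral_indicator[OF m, symmetric])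
  also have "\<dots> = (\<integral>\<^sup>+c. (\<integral>\<^sup>+t. indicator {c \<in> space (lborel_on (insert k I)). c k = c l} (c(k := t))
      \<partial>lborel) \<partial>lborel_on I)"
    by (rule lborel_product.product_nn_integral_insert) (use I m in auto)
  also have "\<dots> = (\<integral>\<^sup>+c. (\<integral>\<^sup>+t. indicator {c l} t \<partial>lborel) \<partial>lborel_on I)"
    using I by (intro nn_integral_cong)
      (auto simp: indicator_def space_PiM PiE_def extensional_def Pi_def)
  also have "\<dots> = 0" by simp
  finally show ?thesis using m by (simp add: null_sets_def)
qed

lemma nn_integral_monomial_Icc:
  fixes K x :: real
  assumes "0 \<le> K" "0 \<le> x"
  shows "(\<integral>\<^sup>+t. ennreal (K * t ^ p) * indicator {0..x} t \<partial>lborel) =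
    ennreal (K * x ^ Suc p / real (Suc p))"
proof -
  have "(\<integral>\<^sup>+t. ennreal (K * t ^ p) * indicator {0..x} t \<partial>lborel) =
      ennreal (K * x ^ Suc p / real (Suc p) - K * 0 ^ Suc p / real (Suc p))"
  proof (rule nn_integral_FTC_Icc)
    fix t :: real assume "t \<in> {0..x}"
    show "((\<lambda>t. K * t ^ Suc p / real (Suc p)) has_real_derivative K * t ^ p) (at t)"
      by (rule derivative_eq_intros refl | simp)+
    show "0 \<le> K * t ^ p" using \<open>t \<in> _\<close> assms by simp
  qed (use assms in auto)
  then show ?thesis by simp
qed

text \<open>
  The integration step of the recursion: \<open>k\<close> is the coordinate that is largest on \<open>A\<close>, and once it has
  the value \<open>t\<close> the other coordinates range over \<open>S t\<close>.
\<close>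

lemma emeasure_max_coordinate:
  assumes I: "finite I" "k \<notin> I"
    and A: "A \<in> sets (lborel_on (insert k I))"
    and A_iff: "\<And>c t. c \<in> space (lborel_on I) \<Longrightarrow>
      c(k := t) \<in> A \<longleftrightarrow> 0 \<le> t \<and> t \<le> x \<and> c \<in> S t"
    and S: "\<And>t. t \<ge> 0 \<Longrightarrow> S t \<in> sets (lborel_on I)"
    and vol: "\<And>t. t \<ge> 0 \<Longrightarrow> emeasure (lborel_on I) (S t) = ennreal (K * t ^ p)"
    and "K \<ge> 0" "x \<ge> 0"
  shows "emeasure (lborel_on (insert k I)) A = ennreal (K * x ^ Suc p / real (Suc p))"
proof -
  have "emeasure (lborel_on (insert k I)) A = (\<integral>\<^sup>+c. indicator A c \<partial>lborel_on (insert k I))"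
    by (rule nn_integral_indicator[OF A, symmetric])
  also have "\<dots> = (\<integral>\<^sup>+t. (\<integral>\<^sup>+c. indicator A (c(k := t)) \<partial>lborel_on I) \<partial>lborel)"
    by (rule lborel_product.product_nn_integral_insert_rev) (use I A in auto)
  also have "\<dots> = (\<integral>\<^sup>+t. ennreal (K * t ^ p) * indicator {0..x} t \<partial>lborel)"
  proof (rule nn_integral_cong)
    fix t :: real
    show "(\<integral>\<^sup>+c. indicator A (c(k := t)) \<partial>lborel_on I) = ennreal (K * t ^ p) * indicator {0..x} t"
    proof (cases "t \<in> {0..x}")
      case True
      have "(\<integral>\<^sup>+c. indicator A (c(k := t)) \<partial>lborel_on I) = (\<integral>\<^sup>+c. indicator (S t) c \<partial>lborel_on I)"
        by (intro nn_integral_cong) (use True in \<open>simp add: indicator_def A_iff\<close>)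
      also have "\<dots> = emeasure (lborel_on I) (S t)"
        by (rule nn_integral_indicator) (use S True in auto)
      finally show ?thesis using True vol by simp
    next
      case False
      have "(\<integral>\<^sup>+c. indicator A (c(k := t)) \<partial>lborel_on I) = (\<integral>\<^sup>+c. 0 \<partial>lborel_on I)"
        by (intro nn_integral_cong) (use False in \<open>auto simp: indicator_def A_iff\<close>)
      then show ?thesis using False by simp
    qed
  qed
  also have "\<dots> = ennreal (K * x ^ Suc p / real (Suc p))"
    by (rule nn_integral_monomial_Icc) fact+
  finally show ?thesis .
qed


definition chain_index :: "nat \<Rightarrow> nat \<Rightarrow> nat \<Rightarrow> nat set" where
  "chain_index M i j = {..<i} \<union> {M..<M + j}"

lemma chain_index_simps:
  "finite (chain_index M i j)" "chain_index M 0 0 = {}"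
  "chain_index M (Suc i) j = insert i (chain_index M i j)"
  "chain_index M i (Suc j) = insert (M + j) (chain_index M i j)"
  "i < M \<Longrightarrow> i \<notin> chain_index M i j" "i \<le> M \<Longrightarrow> M + j \<notin> chain_index M i j"
  by (auto simp: chain_index_def)

lemma chain_bound:
  fixes l q u i j :: nat
  assumes "q * j \<le> i" "l < q * (u + 1)" "u < j"
  shows "l < i"
proof -
  have "q * (u + 1) \<le> q * j" using assms(3) by (intro mult_le_mono2) simp
  then show ?thesis using assms(1,2) by linarith
qed

text \<open>
  The upper bound occurs only in the bounds on single coordinates, hence the value of the largest
  coordinate can take the place of \<open>x\<close>.
\<close>

lemma two_chains_shrink_bound:
  assumes "t \<le> x"
  shows "two_chains q M i j t c \<longleftrightarrow>
    two_chains q M i j x c \<and> (\<forall>l<i. c l \<le> t) \<and> (\<forall>u<j. c (M + u) \<le> t)"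
  using assms unfolding two_chains_def by (meson order_trans)

lemma two_chains_cong:
  assumes "q * j \<le> i" and low: "\<And>l. l < i \<Longrightarrow> c l = c' l"
    and up: "\<And>u. u < j \<Longrightarrow> c (M + u) = c' (M + u)"
  shows "two_chains q M i j x c \<longleftrightarrow> two_chains q M i j x c'"
proof -
  have imp: "two_chains q M i j x g"
    if f: "two_chains q M i j x f" and "\<And>l. l < i \<Longrightarrow> f l = g l" "\<And>u. u < j \<Longrightarrow> f (M + u) = g (M + u)"
    for f g
    unfolding two_chains_def
  proof (intro conjI allI impI)
    fix l l' assume "l < i" "l' < l"
    moreover have "f l' \<le> f l" using f \<open>l < i\<close> \<open>l' < l\<close> unfolding two_chains_def by blast
    ultimately show "g l' \<le> g l" using that(2)[of l] that(2)[of l'] by simp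
  next
    fix u l assume "u < j" "l < q * (u + 1)"
    then have "l < i" using chain_bound[OF assms(1)] by blast
    have "f l \<le> f (M + u)" using f \<open>u < j\<close> \<open>l < q * (u + 1)\<close> unfolding two_chains_def by blast
    then show "g l \<le> g (M + u)" using that(2)[OF \<open>l < i\<close>] that(3)[OF \<open>u < j\<close>] by simp
  next
    fix u u' assume "u < j" "u' < u"
    moreover have "f (M + u') \<le> f (M + u)"
      using f \<open>u < j\<close> \<open>u' < u\<close> unfolding two_chains_def by blast
    ultimately show "g (M + u') \<le> g (M + u)" using that(3)[of u] that(3)[of u'] by simp
  next
    fix l assume "l < i"
    then show "0 \<le> g l" "g l \<le> x" using f that(2)[of l] by (auto simp: two_chains_def)
  next
    fix u assume "u < j"
    then show "0 \<le> g (M + u)" "g (M + u) \<le> x" using f that(3)[of u] by (auto simp: two_chains_def)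
  qed
  show ?thesis using imp[of c c'] imp[of c' c] low up by auto
qed

lemma two_chains_Suc_lower:
  "two_chains q M (Suc i) j x c \<longleftrightarrow>
    two_chains q M i j x c \<and> 0 \<le> c i \<and> c i \<le> x \<and> (\<forall>l<i. c l \<le> c i)"
  unfolding two_chains_def All_less_Suc by blast

lemma two_chains_Suc_upper:
  "two_chains q M i (Suc j) x c \<longleftrightarrow>
    two_chains q M i j x c \<and> 0 \<le> c (M + j) \<and> c (M + j) \<le> x \<and>
    (\<forall>u<j. c (M + u) \<le> c (M + j)) \<and> (\<forall>l<q * (j + 1). c l \<le> c (M + j))"
  unfolding two_chains_def All_less_Suc by blast

text \<open>
  If the largest coordinate belongs to the lower chain, it must not be one that an element of the upper
  chain has to dominate; this is the role of \<open>q * j \<le> i\<close>.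
\<close>

lemma two_chains_lower_max:
  assumes "i < M" "q * j \<le> i"
  shows "two_chains q M (Suc i) j x (c(i := t)) \<and> (\<forall>u<j. c (M + u) \<le> t) \<longleftrightarrow>
    0 \<le> t \<and> t \<le> x \<and> two_chains q M i j t c"
proof -
  have "two_chains q M i j x (c(i := t)) \<longleftrightarrow> two_chains q M i j x c"
    by (rule two_chains_cong) (use assms in auto)
  then show ?thesis
    using two_chains_shrink_bound[of t x q M i j c] by (auto simp: two_chains_Suc_lower)
qed

lemma two_chains_upper_max:
  assumes "i \<le> M" "q * Suc j \<le> i"
  shows "two_chains q M i (Suc j) x (c(M + j := t)) \<and> (\<forall>l<i. c l \<le> t) \<longleftrightarrow>
    0 \<le> t \<and> t \<le> x \<and> two_chains q M i j t c"
proof -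
  have "two_chains q M i j x (c(M + j := t)) \<longleftrightarrow> two_chains q M i j x c"
    by (rule two_chains_cong) (use assms in auto)
  moreover have "l \<noteq> M + j \<and> l < i" if "l < q * (j + 1)" for l
    using that assms by simp
  ultimately show ?thesis
    using two_chains_shrink_bound[of t x q M i j c] by (auto simp: two_chains_Suc_upper)
qed

lemma measurable_two_chains:
  assumes "q * j \<le> i"
  shows "Measurable.pred (lborel_on (chain_index M i j)) (two_chains q M i j x)"
proof -
  let ?N = "lborel_on (chain_index M i j)"
  have m: "(\<lambda>c. c l) \<in> borel_measurable ?N" if "l \<in> chain_index M i j" for l
    using measurable_component_singleton[OF that, of "\<lambda>_. lborel"] by simp
  have le: "Measurable.pred ?N (\<lambda>c. c k \<le> c l)"
    if "k \<in> chain_index M i j" "l \<in> chain_index M i j" for k l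
    unfolding pred_def by (rule borel_measurable_le[OF m[OF that(1)] m[OF that(2)]])
  have ge0: "Measurable.pred ?N (\<lambda>c. 0 \<le> c l)" and lex: "Measurable.pred ?N (\<lambda>c. c l \<le> x)"
    if "l \<in> chain_index M i j" for l
    unfolding pred_def
    by (rule borel_measurable_le[OF borel_measurable_const m[OF that]]
          borel_measurable_le[OF m[OF that] borel_measurable_const])+
  have bound: "l < i" if "l < q * (u + 1)" "u < j" for l u
    using chain_bound[OF assms that] .
  have "two_chains q M i j x = (\<lambda>c.
     (\<forall>l\<in>{..<i}. 0 \<le> c l \<and> c l \<le> x \<and> (\<forall>l'\<in>{..<l}. c l' \<le> c l)) \<and>
     (\<forall>u\<in>{..<j}. 0 \<le> c (M + u) \<and> c (M + u) \<le> x \<and> (\<forall>u'\<in>{..<u}. c (M + u') \<le> c (M + u)) \<and>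
        (\<forall>l\<in>{..<q * (u + 1)}. c l \<le> c (M + u))))"
    by (simp add: two_chains_def fun_eq_iff Ball_def)
  also have "Measurable.pred ?N \<dots>"
    by (intro pred_intros_logic pred_intros_finite le ge0 lex finite_lessThan)
      (use bound in \<open>auto simp: chain_index_def\<close>)
  finally show ?thesis .
qed

definition two_chain_region :: "nat \<Rightarrow> nat \<Rightarrow> nat \<Rightarrow> nat \<Rightarrow> real \<Rightarrow> (nat \<Rightarrow> real) set" where
  "two_chain_region q M i j x =
     {c \<in> space (lborel_on (chain_index M i j)). two_chains q M i j x c}"

lemma sets_two_chain_region:
  "q * j \<le> i \<Longrightarrow> two_chain_region q M i j x \<in> sets (lborel_on (chain_index M i j))"
  unfolding two_chain_region_def using measurable_two_chains by (rule predE)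

lemma fun_upd_in_space:
  assumes "c \<in> space (lborel_on I)"
  shows "c(k := t) \<in> space (lborel_on (insert k I))"
  using assms by (auto simp: space_PiM PiE_def extensional_def)

lemma measurable_component_le:
  assumes "k \<in> I" "l \<in> I"
  shows "Measurable.pred (lborel_on I) (\<lambda>c. c k \<le> c l)"
proof -
  have m: "(\<lambda>c. c i) \<in> borel_measurable (lborel_on I)" if "i \<in> I" for i
    using measurable_component_singleton[OF that, of "\<lambda>_. lborel"] by simp
  show ?thesis
    unfolding pred_def by (rule borel_measurable_le[OF m[OF assms(1)] m[OF assms(2)]])
qed

lemma emeasure_lower_max:
  assumes "i < M" "q * j \<le> i" "K \<ge> 0" "x \<ge> 0"
    and vol: "\<And>t. t \<ge> 0 \<Longrightarrow> emeasure (lborel_on (chain_index M i j)) (two_chain_region q M i j t) =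
      ennreal (K * t ^ p)"
  shows "emeasure (lborel_on (chain_index M (Suc i) j))
      {c \<in> two_chain_region q M (Suc i) j x. \<forall>u<j. c (M + u) \<le> c i} =
    ennreal (K * x ^ Suc p / real (Suc p))"
  unfolding chain_index_simps(3)
proof (rule emeasure_max_coordinate[where S = "two_chain_region q M i j"])
  let ?I = "chain_index M i j"
  have "Measurable.pred (lborel_on (insert i ?I)) (\<lambda>c. \<forall>u\<in>{..<j}. c (M + u) \<le> c i)"
    by (intro pred_intros_finite measurable_component_le) (auto simp: chain_index_def)
  from predE[OF this]
  have "{c \<in> space (lborel_on (insert i ?I)). \<forall>u\<in>{..<j}. c (M + u) \<le> c i}
      \<in> sets (lborel_on (insert i ?I))" .
  from sets.Int[OF sets_two_chain_region[of q j "Suc i" M x, unfolded chain_index_simps(3)] this]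
  show "{c \<in> two_chain_region q M (Suc i) j x. \<forall>u<j. c (M + u) \<le> c i}
      \<in> sets (lborel_on (insert i ?I))"
    using assms(2) by (simp add: two_chain_region_def chain_index_simps(3) Int_def conj_ac Ball_def)
  fix c t assume c: "c \<in> space (lborel_on ?I)"
  show "c(i := t) \<in> {c \<in> two_chain_region q M (Suc i) j x. \<forall>u<j. c (M + u) \<le> c i} \<longleftrightarrow>
      0 \<le> t \<and> t \<le> x \<and> c \<in> two_chain_region q M i j t"
    using two_chains_lower_max[OF assms(1,2), of x c t] fun_upd_in_space[OF c] c assms(1)
    by (auto simp: two_chain_region_def chain_index_simps(3))
qed (use assms in \<open>auto simp: chain_index_simps intro: sets_two_chain_region\<close>)

lemma emeasure_upper_max:
  assumes "i \<le> M" "q * Suc j \<le> i" "K \<ge> 0" "x \<ge> 0"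
    and vol: "\<And>t. t \<ge> 0 \<Longrightarrow> emeasure (lborel_on (chain_index M i j)) (two_chain_region q M i j t) =
      ennreal (K * t ^ p)"
  shows "emeasure (lborel_on (chain_index M i (Suc j)))
      {c \<in> two_chain_region q M i (Suc j) x. \<forall>l<i. c l \<le> c (M + j)} =
    ennreal (K * x ^ Suc p / real (Suc p))"
  unfolding chain_index_simps(4)
proof (rule emeasure_max_coordinate[where S = "two_chain_region q M i j"])
  let ?I = "chain_index M i j"
  have "Measurable.pred (lborel_on (insert (M + j) ?I)) (\<lambda>c. \<forall>l\<in>{..<i}. c l \<le> c (M + j))"
    by (intro pred_intros_finite measurable_component_le) (auto simp: chain_index_def)
  from predE[OF this]
  have "{c \<in> space (lborel_on (insert (M + j) ?I)). \<forall>l\<in>{..<i}. c l \<le> c (M + j)}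
      \<in> sets (lborel_on (insert (M + j) ?I))" .
  from sets.Int[OF sets_two_chain_region[of q "Suc j" i M x, unfolded chain_index_simps(4)] this]
  show "{c \<in> two_chain_region q M i (Suc j) x. \<forall>l<i. c l \<le> c (M + j)}
      \<in> sets (lborel_on (insert (M + j) ?I))"
    using assms(2) by (simp add: two_chain_region_def chain_index_simps(4) Int_def conj_ac Ball_def)
  fix c t assume c: "c \<in> space (lborel_on ?I)"
  show "c(M + j := t) \<in> {c \<in> two_chain_region q M i (Suc j) x. \<forall>l<i. c l \<le> c (M + j)} \<longleftrightarrow>
      0 \<le> t \<and> t \<le> x \<and> c \<in> two_chain_region q M i j t"
    using two_chains_upper_max[OF assms(1,2), of x c t] fun_upd_in_space[OF c] c assms(1)
    by (auto simp: two_chain_region_def chain_index_simps(4))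
qed (use assms in \<open>auto simp: chain_index_simps intro: sets_two_chain_region\<close>)

text \<open>
  The recurrence of the ballot numbers, by the last letter of the sequence, divided by factorials: the
  first summand belongs to sequences that end in the lower chain, the second to those that end in the
  upper chain.
\<close>

lemma ballot_recurrence:
  fixes i j q :: nat
  shows "(real (Suc i) - real q * real (Suc j)) / (fact (Suc i) * fact (Suc j)) / real (Suc i + Suc j) +
    (real (Suc i) + 1 - real q * real j) / (fact (Suc (Suc i)) * fact j) / real (Suc i + Suc j) =
    ((real (Suc i) + 1 - real q * real (Suc j)) / (fact (Suc (Suc i)) * fact (Suc j)) :: real)"
proof -
  define D where "D = (fact (Suc (Suc i)) * fact (Suc j) :: real)"
  define n where "n = real (Suc i + Suc j)"
  have "n \<noteq> 0" by (simp add: n_def)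
  have lower: "(real (Suc i) - real q * real (Suc j)) / (fact (Suc i) * fact (Suc j)) =
      (real (Suc i) - real q * real (Suc j)) * (real i + 2) / D"
    unfolding D_def fact_Suc[of "Suc i"] by (simp add: divide_simps add.commute del: fact_Suc)
  have upper: "(real (Suc i) + 1 - real q * real j) / (fact (Suc (Suc i)) * fact j) =
      (real (Suc i) + 1 - real q * real j) * (real j + 1) / D"
    unfolding D_def fact_Suc[of "j"] by (simp add: divide_simps add.commute del: fact_Suc)
  have "(real (Suc i) - real q * real (Suc j)) * (real i + 2) +
      (real (Suc i) + 1 - real q * real j) * (real j + 1) =
      (real (Suc i) + 1 - real q * real (Suc j)) * n"
    by (simp add: n_def algebra_simps)
  then have "(real (Suc i) - real q * real (Suc j)) * (real i + 2) / D / n +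
      (real (Suc i) + 1 - real q * real j) * (real j + 1) / D / n =
      (real (Suc i) + 1 - real q * real (Suc j)) * n / D / n"
    by (metis add_divide_distrib)
  also have "\<dots> = (real (Suc i) + 1 - real q * real (Suc j)) / D"
    using \<open>n \<noteq> 0\<close> by simp
  finally show ?thesis
    unfolding lower upper unfolding D_def n_def .
qed

text \<open>
  Up to ties, the region splits according to whether the last element of the lower or of the upper chain
  is the largest. If \<open>i = q * j\<close>, the last element of the lower chain is dominated by that of the
  upper chain, so the first part is null; the closed form agrees, as its factor \<open>i - q * j\<close> vanishes.
\<close>

theorem emeasure_two_chain_region:
  assumes "q \<ge> 1" "i \<le> M" "q * j \<le> i" "x \<ge> 0"
  shows "emeasure (lborel_on (chain_index M i j)) (two_chain_region q M i j x) =
    ennreal ((real i + 1 - real q * real j) / (fact (Suc i) * fact j) * x ^ (i + j))"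
  using assms(2-)
proof (induction "i + j" arbitrary: i j x rule: less_induct)
  case (less i j x)
  show ?case
  proof (cases i)
    case 0
    then have "j = 0" using less.prems assms(1) by simp
    moreover have "two_chain_region q M 0 0 x = space (lborel_on {})"
      by (auto simp: two_chain_region_def chain_index_simps two_chains_def)
    ultimately show ?thesis using 0 by (simp add: chain_index_simps space_PiM PiM_empty)
  next
    case (Suc i')
    let ?N = "lborel_on (chain_index M i j)" and ?R = "two_chain_region q M i j x"
    let ?A = "{c \<in> ?R. \<forall>u<j. c (M + u) \<le> c i'}"
    have meas_R: "?R \<in> sets ?N" using less.prems by (intro sets_two_chain_region)
    have qj: "real q * real j \<le> real i"
      using less.prems(2) by (metis of_nat_le_iff of_nat_mult)
    have lower: "emeasure ?N ?A =
        ennreal ((real i' + 1 - real q * real j) / (fact (Suc i') * fact j) * x ^ (i + j) / real (i + j))"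
      if "q * j \<le> i'"
    proof -
      have qj': "real q * real j \<le> real i'"
        using that by (metis of_nat_le_iff of_nat_mult)
      have "emeasure (lborel_on (chain_index M (Suc i') j))
          {c \<in> two_chain_region q M (Suc i') j x. \<forall>u<j. c (M + u) \<le> c i'} =
        ennreal ((real i' + 1 - real q * real j) / (fact (Suc i') * fact j) * x ^ Suc (i' + j) / real (Suc (i' + j)))"
      proof (rule emeasure_lower_max)
        show "emeasure (lborel_on (chain_index M i' j)) (two_chain_region q M i' j t) =
          ennreal ((real i' + 1 - real q * real j) / (fact (Suc i') * fact j) * t ^ (i' + j))" if "0 \<le> t" for t
          by (rule less.hyps) (use Suc less.prems \<open>q * j \<le> i'\<close> that in auto)
      qed (use Suc less.prems that qj' in auto)
      then show ?thesis by (simp add: Suc)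
    qed
    show ?thesis
    proof (cases j)
      case 0
      have "?A = ?R" by (simp add: 0)
      moreover have "(real i' + 1) / fact (Suc i') * x ^ i / real i = (real i + 1) / fact (Suc i) * x ^ i"
      proof -
        have "(real i' + 1) / fact (Suc i') = (1 / fact i' :: real)"
          "(real i + 1) / fact (Suc i) = (1 / fact i :: real)"
          by (simp_all add: divide_simps add.commute)
        then show ?thesis by (simp add: Suc)
      qed
      ultimately show ?thesis using lower by (simp add: 0 del: fact_Suc)
    next
      case (Suc j')
      let ?B = "{c \<in> ?R. \<forall>l<i. c l \<le> c (M + j')}"
      let ?tie = "{c \<in> space ?N. c (M + j') = c i'}"
      have meas_A: "?A \<in> sets ?N"
      proof -
        have "Measurable.pred ?N (\<lambda>c. \<forall>u\<in>{..<j}. c (M + u) \<le> c i')"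
          by (intro pred_intros_finite measurable_component_le) (auto simp: chain_index_def \<open>i = Suc i'\<close>)
        from sets.Int[OF meas_R predE[OF this]] show ?thesis
          by (simp add: two_chain_region_def Int_def conj_ac Ball_def)
      qed
      have meas_B: "?B \<in> sets ?N"
      proof -
        have "Measurable.pred ?N (\<lambda>c. \<forall>l\<in>{..<i}. c l \<le> c (M + j'))"
          by (intro pred_intros_finite measurable_component_le) (auto simp: chain_index_def Suc)
        from sets.Int[OF meas_R predE[OF this]] show ?thesis
          by (simp add: two_chain_region_def Int_def conj_ac Ball_def)
      qed
      have qj'_nat: "q * j' \<le> i" using less.prems(2) by (simp add: Suc)
      have qj': "real q * real j' \<le> real i"
        using qj'_nat by (metis of_nat_le_iff of_nat_mult)
      have upper: "emeasure ?N ?B =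
        ennreal ((real i + 1 - real q * real j') / (fact (Suc i) * fact j') * x ^ (i + j) / real (i + j))"
      proof -
        have "emeasure (lborel_on (chain_index M i (Suc j')))
          {c \<in> two_chain_region q M i (Suc j') x. \<forall>l<i. c l \<le> c (M + j')} =
        ennreal ((real i + 1 - real q * real j') / (fact (Suc i) * fact j') * x ^ Suc (i + j') / real (Suc (i + j')))"
        proof (rule emeasure_upper_max)
          show "emeasure (lborel_on (chain_index M i j')) (two_chain_region q M i j' t) =
            ennreal ((real i + 1 - real q * real j') / (fact (Suc i) * fact j') * t ^ (i + j'))" if "0 \<le> t" for t
            by (rule less.hyps) (use Suc less.prems qj'_nat that in auto)
        qed (use Suc less.prems qj' in auto)
        then show ?thesis by (simp add: Suc)
      qed
      \<comment> \<open>The two parts overlap only where the last elements of the two chains agree.\<close>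
      have null_tie: "?tie \<in> null_sets ?N"
        unfolding Suc chain_index_simps(4)
        by (rule null_sets_tie)
          (use \<open>i = Suc i'\<close> less.prems in \<open>auto simp: chain_index_simps\<close>)
      have lower': "emeasure ?N ?A =
          ennreal ((real i' + 1 - real q * real j) / (fact (Suc i') * fact j) * x ^ (i + j) / real (i + j))"
      proof (cases "q * j \<le> i'")
        case False
        then have eq: "i = q * j" using less.prems(2) \<open>i = Suc i'\<close> by simp
        have "?A \<subseteq> ?tie"
        proof
          fix c assume c: "c \<in> ?A"
          have "i' < q * (j' + 1)" using eq \<open>i = Suc i'\<close> Suc by simp
          then have "c i' \<le> c (M + j')"
            using c Suc by (auto simp: two_chain_region_def two_chains_def)
          then show "c \<in> ?tie" using c Suc by (auto simp: two_chain_region_def intro: antisym)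
        qed
        then have "emeasure ?N ?A = 0"
          using null_tie meas_A by (meson null_sets_subset null_setsD1)
        moreover have "real i' + 1 - real q * real j = 0"
          using eq \<open>i = Suc i'\<close> by (metis of_nat_Suc of_nat_mult diff_self add.commute)
        ultimately show ?thesis by simp
      qed (use lower in simp)
      have split: "?R = ?A \<union> ?B"
      proof (intro equalityI subsetI)
        fix c assume c: "c \<in> ?R"
        then have tc: "two_chains q M i j x c" by (simp add: two_chain_region_def)
        have up: "c (M + u) \<le> c (M + j')" if "u < j" for u
          using tc that Suc by (auto simp: two_chains_def less_Suc_eq)
        have lo: "c l \<le> c i'" if "l < i" for l
          using tc that \<open>i = Suc i'\<close> by (auto simp: two_chains_def less_Suc_eq)
        show "c \<in> ?A \<union> ?B"
          using c up lo by (cases "c (M + j') \<le> c i'") (force intro: order_trans)+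
      qed auto
      have "?A \<inter> ?B \<subseteq> ?tie"
        using \<open>i = Suc i'\<close> Suc by (auto simp: two_chain_region_def intro: antisym)
      then have "AE c in ?N. \<not> (c \<in> ?A \<and> c \<in> ?B)"
        by (intro AE_I'[OF null_tie]) blast
      then have "emeasure ?N ?R = emeasure ?N ?A + emeasure ?N ?B"
        using split by (intro emeasure_add_AE meas_A meas_B meas_R) auto
      also have "\<dots> = ennreal ((real i' + 1 - real q * real j) / (fact (Suc i') * fact j) * x ^ (i + j) / real (i + j) +
         (real i + 1 - real q * real j') / (fact (Suc i) * fact j') * x ^ (i + j) / real (i + j))"
        unfolding lower' upper
        by (rule ennreal_plus[symmetric]) (use qj qj' \<open>i = Suc i'\<close> less.prems in auto)
      also have "(real i' + 1 - real q * real j) / (fact (Suc i') * fact j) * x ^ (i + j) / real (i + j) +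
         (real i + 1 - real q * real j') / (fact (Suc i) * fact j') * x ^ (i + j) / real (i + j) =
         ((real i' + 1 - real q * real j) / (fact (Suc i') * fact j) / real (i + j) +
         (real i + 1 - real q * real j') / (fact (Suc i) * fact j') / real (i + j)) * x ^ (i + j)"
        by (simp add: distrib_right)
      also have "(real i' + 1 - real q * real j) / (fact (Suc i') * fact j) / real (i + j) +
         (real i + 1 - real q * real j') / (fact (Suc i) * fact j') / real (i + j) =
         (real i + 1 - real q * real j) / (fact (Suc i) * fact j)"
        using ballot_recurrence[of i' q j'] unfolding \<open>i = Suc i'\<close> Suc
        by (simp only: of_nat_Suc add.commute)
      finally show ?thesis .
    qed
  qed
qed

section \<open>Affine hulls and affine functions of coordinates\<close>

lemma lookup_scaleR: "Poly_Mapping.lookup (r *\<^sub>R x) e = r *\<^sub>R Poly_Mapping.lookup x e"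
proof -
  have "finite {i. r *\<^sub>R Poly_Mapping.lookup x i \<noteq> 0}"
    by (rule finite_subset[OF _ finite_lookup[of x]]) auto
  then show ?thesis by (simp add: scaleR_poly_mapping_def)
qed

lemma lookup_lin_comb:
  fixes b :: "nat \<Rightarrow> 'e \<Rightarrow>\<^sub>0 real"
  shows "Poly_Mapping.lookup (lin_comb d b c) e = (\<Sum>i<d. c i * Poly_Mapping.lookup (b i) e)"
  unfolding lin_comb_def lookup_sum lookup_scaleR by simp

lemma lin_comb_combine:
  "lin_comb d b (\<lambda>i. u * c i + v * c' i) = u *\<^sub>R lin_comb d b c + v *\<^sub>R lin_comb d b c'"
  by (simp add: lin_comb_def scaleR_add_left sum.distrib scaleR_sum_right)

text \<open>
  A point of \<open>P\<close> at which no inequality is tight is interior: from there one can move a little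
  towards any point of the affine space without leaving \<open>P\<close>, and the line through the two points of
  \<open>P\<close> obtained in this way contains the given point.
\<close>

lemma affine_hull_positive_part:
  fixes b :: "nat \<Rightarrow> 'e \<Rightarrow>\<^sub>0 real"
  assumes P: "P = {f \<in> range (\<lambda>c. p + lin_comb d b c). \<forall>e\<in>A. 0 \<le> Poly_Mapping.lookup f e}"
    and A: "finite A"
    and pos: "\<And>e. e \<in> A \<Longrightarrow> 0 < Poly_Mapping.lookup (p + lin_comb d b c0) e"
  shows "affine hull P = range (\<lambda>c. p + lin_comb d b c)" (is "_ = ?L")
proof (rule equalityI)
  have combine: "u *\<^sub>R (p + lin_comb d b c) + v *\<^sub>R (p + lin_comb d b c') =
      p + lin_comb d b (\<lambda>i. u * c i + v * c' i)" if "u + v = 1" for u v c c'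
    using that scaleR_add_left[of u v p]
    by (simp add: lin_comb_combine scaleR_add_right algebra_simps)
  have "affine ?L"
    unfolding affine_def by (auto simp: combine)
  moreover have "P \<subseteq> ?L" using P by auto
  ultimately show "affine hull P \<subseteq> ?L" by (simp add: hull_minimal)
  show "?L \<subseteq> affine hull P"
  proof
    fix x assume "x \<in> ?L"
    then obtain c where x: "x = p + lin_comb d b c" by auto
    let ?z = "p + lin_comb d b c0"
    have "\<exists>\<epsilon>>0. \<forall>e\<in>A. 0 \<le> (1 - \<epsilon>) * Poly_Mapping.lookup ?z e + \<epsilon> * Poly_Mapping.lookup x e"
    proof -
      have "\<forall>\<^sub>F \<epsilon> in at_right 0.
          0 < (1 - \<epsilon>) * Poly_Mapping.lookup ?z e + \<epsilon> * Poly_Mapping.lookup x e" if "e \<in> A" for e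
      proof (rule order_tendstoD(1))
        have "((\<lambda>\<epsilon>. (1 - \<epsilon>) * Poly_Mapping.lookup ?z e + \<epsilon> * Poly_Mapping.lookup x e) \<longlongrightarrow>
            (1 - 0) * Poly_Mapping.lookup ?z e + 0 * Poly_Mapping.lookup x e) (at_right 0)"
          by (intro tendsto_intros)
        then show "((\<lambda>\<epsilon>. (1 - \<epsilon>) * Poly_Mapping.lookup ?z e + \<epsilon> * Poly_Mapping.lookup x e) \<longlongrightarrow>
            Poly_Mapping.lookup ?z e) (at_right 0)" by simp
      qed (rule pos[OF that])
      then have "\<forall>\<^sub>F \<epsilon> in at_right 0. \<forall>e\<in>A.
          0 < (1 - \<epsilon>) * Poly_Mapping.lookup ?z e + \<epsilon> * Poly_Mapping.lookup x e"
        using A by (intro eventually_ball_finite) auto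
      then have "\<forall>\<^sub>F \<epsilon> in at_right 0. \<epsilon> > 0 \<and> (\<forall>e\<in>A.
          0 < (1 - \<epsilon>) * Poly_Mapping.lookup ?z e + \<epsilon> * Poly_Mapping.lookup x e)"
        using eventually_at_right_less by (rule eventually_conj[rotated])
      from eventually_happens'[OF _ this]
      show ?thesis by (force intro: less_imp_le)
    qed
    then obtain \<epsilon> where \<epsilon>: "\<epsilon> > 0"
      "\<And>e. e \<in> A \<Longrightarrow> 0 \<le> (1 - \<epsilon>) * Poly_Mapping.lookup ?z e + \<epsilon> * Poly_Mapping.lookup x e" by blast
    \<comment> \<open>The line through the interior point and \<open>w\<close> contains \<open>x\<close>.\<close>
    define w where "w = (1 - \<epsilon>) *\<^sub>R ?z + \<epsilon> *\<^sub>R x"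
    have "w \<in> ?L" unfolding w_def x by (subst combine) auto
    moreover have "0 \<le> Poly_Mapping.lookup w e" if "e \<in> A" for e
      using \<epsilon>(2)[OF that] by (simp add: w_def lookup_add[of "(1 - \<epsilon>) *\<^sub>R ?z"] lookup_scaleR)
    ultimately have "w \<in> P" using P by blast
    moreover have "?z \<in> P" using P pos by (auto intro: less_imp_le)
    ultimately have "(1 / \<epsilon>) *\<^sub>R w + (1 - 1 / \<epsilon>) *\<^sub>R ?z \<in> affine hull P"
      by (intro mem_affine[OF affine_affine_hull]) (auto intro: hull_inc)
    also have "(1 / \<epsilon>) *\<^sub>R w + (1 - 1 / \<epsilon>) *\<^sub>R ?z = x"
    proof -
      have "(1 / \<epsilon>) *\<^sub>R w = ((1 - \<epsilon>) / \<epsilon>) *\<^sub>R ?z + x"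
        using \<epsilon>(1) by (simp add: w_def scaleR_add_right)
      then have "(1 / \<epsilon>) *\<^sub>R w + (1 - 1 / \<epsilon>) *\<^sub>R ?z = ((1 - \<epsilon>) / \<epsilon> + (1 - 1 / \<epsilon>)) *\<^sub>R ?z + x"
        by (simp only: scaleR_add_left ac_simps)
      also have "(1 - \<epsilon>) / \<epsilon> + (1 - 1 / \<epsilon>) = 0" using \<epsilon>(1) by (simp add: field_simps)
      finally show ?thesis by simp
    qed
    finally show "x \<in> affine hull P" .
  qed
qed

definition unit_vec :: "nat \<Rightarrow> nat \<Rightarrow> real" where
  "unit_vec i = (\<lambda>j. if j = i then 1 else 0)"

text \<open>
  An affine function is recovered from its values at 0 and at the unit vectors, and ignores the
  components from \<open>d\<close> on. In this form the values directly give the origin and the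
  directions of a frame.
\<close>

definition affine_map :: "nat \<Rightarrow> ((nat \<Rightarrow> real) \<Rightarrow> real) \<Rightarrow> bool" where
  "affine_map d f \<longleftrightarrow>
    (\<forall>c. f c = f (\<lambda>_. 0) + (\<Sum>i<d. c i * (f (unit_vec i) - f (\<lambda>_. 0))))"

lemma affine_map_const: "affine_map d (\<lambda>c. K)"
  by (simp add: affine_map_def)

lemma affine_map_component: "i < d \<Longrightarrow> affine_map d (\<lambda>c. c i)"
  by (simp add: affine_map_def unit_vec_def if_distrib[of "\<lambda>x. _ * x"] cong: if_cong)

lemma affine_map_diff:
  assumes "affine_map d f" "affine_map d g"
  shows "affine_map d (\<lambda>c. f c - g c)"
  unfolding affine_map_def
proof
  fix c
  have "f c - g c = (f (\<lambda>_. 0) + (\<Sum>i<d. c i * (f (unit_vec i) - f (\<lambda>_. 0)))) -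
      (g (\<lambda>_. 0) + (\<Sum>i<d. c i * (g (unit_vec i) - g (\<lambda>_. 0))))"
    using assms unfolding affine_map_def by metis
  then show "f c - g c = f (\<lambda>_. 0) - g (\<lambda>_. 0) +
      (\<Sum>i<d. c i * (f (unit_vec i) - g (unit_vec i) - (f (\<lambda>_. 0) - g (\<lambda>_. 0))))"
    by (simp add: right_diff_distrib sum_subtractf)
qed

lemma affine_map_sum:
  assumes "finite K" "\<And>k. k \<in> K \<Longrightarrow> affine_map d (f k)"
  shows "affine_map d (\<lambda>c. \<Sum>k\<in>K. f k c)"
  using assms
proof (induction K rule: finite_induct)
  case empty
  show ?case by (simp add: affine_map_const)
next
  case (insert k K)
  have "affine_map d (\<lambda>c. f k c - (0 - (\<Sum>k\<in>K. f k c)))"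
    using insert by (intro affine_map_diff affine_map_const) auto
  then show ?case using insert by simp
qed

section \<open>The arcs of the network and their flow equations\<close>

text \<open>
  The graph of the theorem has \<open>m + 1\<close> vertices besides \<open>s\<close> and \<open>t\<close>. Vertex \<open>m + 1 - u\<close> is said to have level
  \<open>u\<close>: sums start at the largest vertex, which has level 0, while vertex 1 has level \<open>m\<close>.
\<close>

locale fan_path_network =
  fixes m r :: nat
  assumes m_ge: "2 \<le> m"
begin

definition src :: "nat \<Rightarrow> (nat \<times> nat) \<times> nat" where "src u = ((0, Suc m - u), 0)"
definition snk :: "nat \<Rightarrow> (nat \<times> nat) \<times> nat" where "snk u = ((Suc m - u, Suc m + 1), 0)"
definition fan :: "nat \<Rightarrow> nat \<Rightarrow> (nat \<times> nat) \<times> nat" where "fan u k = ((1, Suc m - u), k)"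
text \<open>
  The path arc that enters level \<open>u\<close>. For \<open>u = m - 1\<close> it runs parallel to the \<open>r\<close> arcs from vertex 1 to
  vertex 2 that belong to the fan, and is the last of the \<open>r + 1\<close> copies.
\<close>

definition path_arc :: "nat \<Rightarrow> (nat \<times> nat) \<times> nat" where
  "path_arc u = ((Suc m - u - 1, Suc m - u), if u = m - 1 then r else 0)"

definition H :: "(nat, (nat \<times> nat) \<times> nat) pre_digraph" where
  "H = tilde_graph (m + 1) (G_edges (m - 1) r)"

lemma count_edges:
  "count (G_edges (m - 1) r + (\<Sum>i\<in>{1..m + 1}. {#(0, i), (i, m + 1 + 1)#})) (a, b) =
    (if a = 1 \<and> b = 2 then r + 1 else 0) + (if a = 1 \<and> 3 \<le> b \<and> b \<le> Suc m then r else 0) +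
    (if b = a + 1 \<and> 3 \<le> b \<and> b \<le> Suc m then 1 else 0) +
    (if a = 0 \<and> 1 \<le> b \<and> b \<le> Suc m then 1 else 0) + (if b = Suc m + 1 \<and> 1 \<le> a \<and> a \<le> Suc m then 1 else 0)"
proof -
  have N: "m - 1 + 2 = Suc m" "m + 1 = Suc m" using m_ge by auto
  have fan: "count (\<Sum>i\<in>{3..L}. replicate_mset r (1, i)) (a, b) =
      (if a = 1 \<and> 3 \<le> b \<and> b \<le> L then r else 0)" for L
  proof -
    have "count (\<Sum>i\<in>{3..L}. replicate_mset r (1, i)) (a, b) =
        (\<Sum>i\<in>{3..L}. if i = b then (if a = 1 then r else 0) else 0)"
      unfolding count_sum by (intro sum.cong) auto
    then show ?thesis by (simp add: sum.delta)
  qed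
  have path_arc: "count (\<Sum>i\<in>{3..L}. {#(i - 1, i)#}) (a, b) =
      (if b = a + 1 \<and> 3 \<le> b \<and> b \<le> L then 1 else 0)" for L
  proof -
    have "count (\<Sum>i\<in>{3..L}. {#(i - 1, i)#}) (a, b) =
        (\<Sum>i\<in>{3..L}. if i = b then (if b = a + 1 then 1 else 0) else 0)"
      unfolding count_sum by (intro sum.cong) auto
    then show ?thesis by (simp add: sum.delta)
  qed
  have outer: "count (\<Sum>i\<in>{1..L}. {#(0, i), (i, K)#}) (a, b) =
      (if a = 0 \<and> 1 \<le> b \<and> b \<le> L then 1 else 0) + (if b = K \<and> 1 \<le> a \<and> a \<le> L then 1 else 0)"
    for L K
  proof -
    have "count (\<Sum>i\<in>{1..L}. {#(0, i), (i, K)#}) (a, b) =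
        (\<Sum>i\<in>{1..L}. (if i = b then (if a = 0 then 1 else 0) else 0) +
          (if i = a then (if b = K then 1 else 0) else 0))"
      unfolding count_sum by (intro sum.cong) auto
    then show ?thesis by (simp add: sum.delta sum.distrib)
  qed
  show ?thesis
    unfolding G_edges_def N count_union fan path_arc outer by simp
qed

lemma arcs_H_iff:
  "((a, b), k) \<in> arcs H \<longleftrightarrow> k <
    (if a = 1 \<and> b = 2 then r + 1 else 0) + (if a = 1 \<and> 3 \<le> b \<and> b \<le> Suc m then r else 0) +
    (if b = a + 1 \<and> 3 \<le> b \<and> b \<le> Suc m then 1 else 0) +
    (if a = 0 \<and> 1 \<le> b \<and> b \<le> Suc m then 1 else 0) +
    (if b = Suc m + 1 \<and> 1 \<le> a \<and> a \<le> Suc m then 1 else 0)"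
  unfolding count_edges[symmetric] by (simp add: H_def tilde_graph_def multigraph_def)

lemma arcs_H:
  "arcs H = src ` {..m} \<union> snk ` {..m} \<union> (\<lambda>(u, k). fan u k) ` ({..<m} \<times> {..<r}) \<union> path_arc ` {..<m}"
  (is "_ = ?A")
proof (intro equalityI subsetI)
  fix e assume "e \<in> arcs H"
  obtain a b k where e: "e = ((a, b), k)" by (metis prod.exhaust)
  have k: "((a, b), k) \<in> arcs H"
    using \<open>e \<in> arcs H\<close> by (simp add: e)
  consider "a = 0" "1 \<le> b" "b \<le> Suc m" "k = 0" | "b = Suc m + 1" "1 \<le> a" "a \<le> Suc m" "k = 0"
    | "a = 1" "2 \<le> b" "b \<le> Suc m" "k < r" | "a = 1" "b = 2" "k = r" | "b = a + 1" "3 \<le> b" "b \<le> Suc m" "k = 0"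
    using k m_ge unfolding arcs_H_iff
    by (cases "k < r"; cases "k = r"; cases "a = 1"; cases "b = 2") (auto split: if_splits)
  then show "e \<in> ?A"
  proof cases
    case 1
    then have "e = src (Suc m - b)" "Suc m - b \<le> m" by (auto simp: e src_def)
    then show ?thesis by blast
  next
    case 2
    then have "e = snk (Suc m - a)" "Suc m - a \<le> m" by (auto simp: e snk_def)
    then show ?thesis by blast
  next
    case 3
    then have "e = fan (Suc m - b) k" "Suc m - b < m" by (auto simp: e fan_def)
    then show ?thesis using \<open>k < r\<close> by auto
  next
    case 4
    then have "e = path_arc (m - 1)" "m - 1 < m" using m_ge by (auto simp: e path_arc_def)
    then show ?thesis by blast
  next
    case 5
    then have "e = path_arc (Suc m - b)" "Suc m - b < m" by (auto simp: e path_arc_def)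
    then show ?thesis by blast
  qed
next
  fix e assume "e \<in> ?A"
  moreover have "src u \<in> arcs H" "snk u \<in> arcs H" if "u \<le> m" for u
    unfolding src_def snk_def arcs_H_iff using that m_ge by auto
  moreover have "fan u k \<in> arcs H" if "u < m" "k < r" for u k
    unfolding fan_def arcs_H_iff using that by (cases "u = m - 1") auto
  moreover have "path_arc u \<in> arcs H" if "u < m" for u
    unfolding path_arc_def arcs_H_iff using that m_ge by (cases "u = m - 1") auto
  ultimately show "e \<in> arcs H" by auto
qed

lemma arc_mem:
  "u \<le> m \<Longrightarrow> src u \<in> arcs H" "u \<le> m \<Longrightarrow> snk u \<in> arcs H"
  "u < m \<Longrightarrow> k < r \<Longrightarrow> fan u k \<in> arcs H" "u < m \<Longrightarrow> path_arc u \<in> arcs H"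
  unfolding arcs_H by auto

lemma arcs_H_cases [consumes 1]:
  assumes "e \<in> arcs H"
  obtains u where "u < m" "e = src u" | "e = src m" | u where "u \<le> m" "e = snk u"
    | u k where "u < m" "k < r" "e = fan u k" | u where "u < m" "e = path_arc u"
  using assms unfolding arcs_H by (fastforce simp: le_less)

lemma finite_arcs_H: "finite (arcs H)"
  unfolding arcs_H by (intro finite_UnI finite_imageI finite_cartesian_product) auto

lemma verts_H: "verts H = {0..Suc (Suc m)}"
  by (auto simp: H_def tilde_graph_def multigraph_def)

lemma tail_H [simp]:
  "tail H (src u) = 0" "tail H (snk u) = Suc m - u" "tail H (fan u k) = 1" "tail H (path_arc u) = m - u"
  by (simp_all add: H_def tilde_graph_def multigraph_def src_def snk_def fan_def path_arc_def)

lemma head_H [simp]: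
  "head H (src u) = Suc m - u" "head H (snk u) = Suc (Suc m)" "head H (fan u k) = Suc m - u"
  "head H (path_arc u) = Suc m - u"
  by (simp_all add: H_def tilde_graph_def multigraph_def src_def snk_def fan_def path_arc_def)

text \<open>
  Since the four families of arcs are disjoint and listed without repetition, sums over incoming or
  outgoing arcs can be evaluated by adding a condition on the head or the tail to each summand.
\<close>

lemma sum_arcs_H:
  fixes h :: "_ \<Rightarrow> real"
  shows "(\<Sum>e\<in>arcs H. h e) = (\<Sum>u\<le>m. h (src u)) + (\<Sum>u\<le>m. h (snk u)) +
    (\<Sum>u<m. \<Sum>k<r. h (fan u k)) + (\<Sum>u<m. h (path_arc u))"
proof -
  have inj: "inj_on src {..m}" "inj_on snk {..m}" "inj_on path_arc {..<m}"
    "inj_on (\<lambda>(u, k). fan u k) ({..<m} \<times> {..<r})"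
    by (auto simp: inj_on_def src_def snk_def path_arc_def fan_def)
  have disj: "src ` {..m} \<inter> snk ` {..m} = {}"
    "(src ` {..m} \<union> snk ` {..m}) \<inter> (\<lambda>(u, k). fan u k) ` ({..<m} \<times> {..<r}) = {}"
    "(src ` {..m} \<union> snk ` {..m} \<union> (\<lambda>(u, k). fan u k) ` ({..<m} \<times> {..<r})) \<inter> path_arc ` {..<m} = {}"
    by (auto simp: src_def snk_def path_arc_def fan_def split: if_splits)
  show ?thesis
    unfolding arcs_H using inj disj
    by (simp add: sum.union_disjoint sum.reindex sum.cartesian_product case_prod_unfold)
qed

lemma sum_in_arcs_H:
  fixes g :: "_ \<Rightarrow> real"
  shows "(\<Sum>e\<in>in_arcs H v. g e) = (\<Sum>e\<in>arcs H. if head H e = v then g e else 0)"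
  unfolding in_arcs_def by (rule sum.inter_filter[OF finite_arcs_H])

lemma sum_out_arcs_H:
  fixes g :: "_ \<Rightarrow> real"
  shows "(\<Sum>e\<in>out_arcs H v. g e) = (\<Sum>e\<in>arcs H. if tail H e = v then g e else 0)"
  unfolding out_arcs_def by (rule sum.inter_filter[OF finite_arcs_H])

lemma sum_if_single:
  fixes f :: "nat \<Rightarrow> real"
  assumes "\<And>x. x \<in> A \<Longrightarrow> P x \<longleftrightarrow> x = a" "finite A" "a \<in> A"
  shows "(\<Sum>x\<in>A. if P x then f x else 0) = f a"
proof -
  have "(\<Sum>x\<in>A. if P x then f x else 0) = (\<Sum>x\<in>A. if x = a then f x else 0)"
    using assms(1) by (intro sum.cong) auto
  then show ?thesis using assms by simp
qed

lemma sum_if_none: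
  fixes f :: "nat \<Rightarrow> real"
  assumes "\<And>x. x \<in> A \<Longrightarrow> \<not> P x"
  shows "(\<Sum>x\<in>A. if P x then f x else 0) = 0"
  using assms by (intro sum.neutral) auto

lemma sum_out_source:
  fixes g :: "_ \<Rightarrow> real"
  shows "(\<Sum>e\<in>out_arcs H 0. g e) = (\<Sum>u\<le>m. g (src u))"
proof -
  have "(\<Sum>u\<le>m. if Suc m - u = 0 then g (snk u) else 0) = 0"
    "(\<Sum>u<m. if m - u = 0 then g (path_arc u) else 0) = 0"
    by (rule sum_if_none; simp)+
  then show ?thesis unfolding sum_out_arcs_H sum_arcs_H tail_H by simp
qed

lemma sum_in_sink:
  fixes g :: "_ \<Rightarrow> real"
  shows "(\<Sum>e\<in>in_arcs H (Suc (Suc m)). g e) = (\<Sum>u\<le>m. g (snk u))"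
proof -
  have none: "Suc m - u \<noteq> Suc (Suc m)" for u by simp
  show ?thesis unfolding sum_in_arcs_H sum_arcs_H head_H by (simp add: none)
qed

lemma sum_in_first:
  fixes g :: "_ \<Rightarrow> real"
  shows "(\<Sum>e\<in>in_arcs H 1. g e) = g (src m)"
proof -
  have src: "(\<Sum>u\<le>m. if Suc m - u = 1 then g (src u) else 0) = g (src m)"
    by (rule sum_if_single) auto
  have fan: "(\<Sum>u<m. \<Sum>k<r. if Suc m - u = 1 then g (fan u k) else 0) = 0"
    by (intro sum.neutral ballI) auto
  have path_arc: "(\<Sum>u<m. if Suc m - u = 1 then g (path_arc u) else 0) = 0"
    by (rule sum_if_none) auto
  show ?thesis unfolding sum_in_arcs_H sum_arcs_H head_H src fan path_arc by simp
qed

lemma sum_out_first: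
  fixes g :: "_ \<Rightarrow> real"
  shows "(\<Sum>e\<in>out_arcs H 1. g e) =
    g (snk m) + g (path_arc (m - 1)) + (\<Sum>u<m. \<Sum>k<r. g (fan u k))"
proof -
  have snk: "(\<Sum>u\<le>m. if Suc m - u = 1 then g (snk u) else 0) = g (snk m)"
    by (rule sum_if_single) auto
  have path_arc: "(\<Sum>u<m. if m - u = 1 then g (path_arc u) else 0) = g (path_arc (m - 1))"
    by (rule sum_if_single) (use m_ge in auto)
  show ?thesis unfolding sum_out_arcs_H sum_arcs_H tail_H snk path_arc by simp
qed

lemma sum_in_level:
  fixes g :: "_ \<Rightarrow> real"
  assumes "u < m"
  shows "(\<Sum>e\<in>in_arcs H (Suc m - u). g e) = g (src u) + g (path_arc u) + (\<Sum>k<r. g (fan u k))"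
proof -
  have src: "(\<Sum>x\<le>m. if Suc m - x = Suc m - u then g (src x) else 0) = g (src u)"
    by (rule sum_if_single) (use assms in auto)
  have path_arc: "(\<Sum>x<m. if Suc m - x = Suc m - u then g (path_arc x) else 0) = g (path_arc u)"
    by (rule sum_if_single) (use assms in auto)
  have "(\<Sum>x<m. \<Sum>k<r. if Suc m - x = Suc m - u then g (fan x k) else 0) =
      (\<Sum>x<m. if Suc m - x = Suc m - u then \<Sum>k<r. g (fan x k) else 0)"
    by (intro sum.cong) auto
  also have "\<dots> = (\<Sum>k<r. g (fan u k))"
    by (rule sum_if_single) (use assms in auto)
  finally have fan: "(\<Sum>x<m. \<Sum>k<r. if Suc m - x = Suc m - u then g (fan x k) else 0) =
      (\<Sum>k<r. g (fan u k))" .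
  have "Suc (Suc m) \<noteq> Suc m - u" by simp
  then show ?thesis unfolding sum_in_arcs_H sum_arcs_H head_H src path_arc fan by simp
qed

lemma sum_out_level:
  fixes g :: "_ \<Rightarrow> real"
  assumes "u < m"
  shows "(\<Sum>e\<in>out_arcs H (Suc m - u). g e) = g (snk u) + (if u = 0 then 0 else g (path_arc (u - 1)))"
proof -
  have snk: "(\<Sum>x\<le>m. if Suc m - x = Suc m - u then g (snk x) else 0) = g (snk u)"
    by (rule sum_if_single) (use assms in auto)
  have path_arc: "(\<Sum>x<m. if m - x = Suc m - u then g (path_arc x) else 0) =
      (if u = 0 then 0 else g (path_arc (u - 1)))"
  proof (cases "u = 0")
    case True
    then show ?thesis by (simp add: sum_if_none)
  next
    case False
    have "(\<Sum>x<m. if m - x = Suc m - u then g (path_arc x) else 0) = g (path_arc (u - 1))"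
      by (rule sum_if_single) (use assms False in auto)
    then show ?thesis using False by simp
  qed
  have "0 \<noteq> Suc m - u" "1 \<noteq> Suc m - u" using assms by auto
  then show ?thesis unfolding sum_out_arcs_H sum_arcs_H tail_H snk path_arc by simp
qed

definition is_flow :: "((nat \<times> nat) \<times> nat \<Rightarrow> real) \<Rightarrow> bool" where
  "is_flow g \<longleftrightarrow> (\<Sum>u\<le>m. g (src u)) = 1 \<and> (\<Sum>u\<le>m. g (snk u)) = 1 \<and>
     g (src m) = g (snk m) + g (path_arc (m - 1)) + (\<Sum>u<m. \<Sum>k<r. g (fan u k)) \<and>
     (\<forall>u<m. g (src u) + g (path_arc u) + (\<Sum>k<r. g (fan u k)) =
        g (snk u) + (if u = 0 then 0 else g (path_arc (u - 1))))"

lemma flow_polytope_H: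
  "flow_polytope H = {f. Poly_Mapping.keys f \<subseteq> arcs H \<and> is_flow (Poly_Mapping.lookup f) \<and>
    (\<forall>e\<in>arcs H. 0 \<le> Poly_Mapping.lookup f e)}"
proof -
  have min: "Min (verts H) = 0" unfolding verts_H by (intro Min_eqI) auto
  have max: "Max (verts H) = Suc (Suc m)" unfolding verts_H by (intro Max_eqI) auto
  have inner: "verts H - {0, Suc (Suc m)} = insert 1 ((\<lambda>u. Suc m - u) ` {..<m})"
  proof (intro equalityI subsetI)
    fix v assume "v \<in> verts H - {0, Suc (Suc m)}"
    then have "v = Suc m - (Suc m - v)" "v = 1 \<or> Suc m - v < m" by (auto simp: verts_H)
    then show "v \<in> insert 1 ((\<lambda>u. Suc m - u) ` {..<m})" by (metis image_eqI insert_iff lessThan_iff)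
  qed (auto simp: verts_H)
  have "(\<forall>v\<in>verts H - {0, Suc (Suc m)}. (\<Sum>e\<in>in_arcs H v. g e) = (\<Sum>e\<in>out_arcs H v. g e)) \<longleftrightarrow>
      g (src m) = g (snk m) + g (path_arc (m - 1)) + (\<Sum>u<m. \<Sum>k<r. g (fan u k)) \<and>
      (\<forall>u<m. g (src u) + g (path_arc u) + (\<Sum>k<r. g (fan u k)) =
        g (snk u) + (if u = 0 then 0 else g (path_arc (u - 1))))" for g :: "_ \<Rightarrow> real"
  proof -
    have "(\<forall>v\<in>verts H - {0, Suc (Suc m)}. (\<Sum>e\<in>in_arcs H v. g e) = (\<Sum>e\<in>out_arcs H v. g e)) \<longleftrightarrow>
      (\<Sum>e\<in>in_arcs H 1. g e) = (\<Sum>e\<in>out_arcs H 1. g e) \<and>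
      (\<forall>u<m. (\<Sum>e\<in>in_arcs H (Suc m - u). g e) = (\<Sum>e\<in>out_arcs H (Suc m - u). g e))"
      unfolding inner by blast
    then show ?thesis unfolding sum_in_first sum_out_first by (simp add: sum_in_level sum_out_level)
  qed
  note balance = this
  show ?thesis
    unfolding flow_polytope_def Let_def min max sum_out_source sum_in_sink is_flow_def balance
    by (intro Collect_cong iffI conjI) (elim conjE; assumption)+
qed

section \<open>Partial sums as coordinates of flows\<close>

definition q :: nat where "q = Suc r"

lemma q_pos: "q > 0" by (simp add: q_def)

text \<open>
  The partial sums \<open>s_0 = 0, s_1, s_2, \<dots>\<close> of the flow entering the levels from \<open>s\<close> and through the fan.
\<close>

definition lower :: "(nat \<Rightarrow> real) \<Rightarrow> nat \<Rightarrow> real" where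
  "lower c l = (if l = 0 then 0 else c (l - 1))"

text \<open>
  The partial sums \<open>a_0 = 0, a_1, \<dots>, a_m\<close> of the flow to the sink. The total flow is 1, so
  \<open>a_(m + 1) = 1\<close>; with this convention vertex 1 is no exception in the formula for the flow to the
  sink.
\<close>

definition upper :: "(nat \<Rightarrow> real) \<Rightarrow> nat \<Rightarrow> real" where
  "upper c j = (if j = 0 then 0 else if j \<le> m then c (q * m + (j - 1)) else 1)"

text \<open>
  The flow with given partial sums. The cases are, in this order, the arcs to the sink, the arc from
  the source to vertex 1, the other arcs from the source, the fan, and the path. The value on the path
  is the flow to the sink from levels up to \<open>u\<close> that is not supplied there by the source or the fan.
\<close>

definition arc_value :: "(nat \<Rightarrow> real) \<Rightarrow> (nat \<times> nat) \<times> nat \<Rightarrow> real" where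
  "arc_value c = (\<lambda>((a, b), k).
    if b = Suc (Suc m) then upper c (Suc (Suc m - a)) - upper c (Suc m - a)
    else let u = Suc m - b in
      if a = 0 then
        (if u = m then 1 - (\<Sum>u<m. lower c (Suc (q * u)) - lower c (q * u))
         else lower c (Suc (q * u)) - lower c (q * u))
      else if a = 1 \<and> k < r then lower c (Suc (Suc (q * u + k))) - lower c (Suc (q * u + k))
      else upper c (Suc u) - lower c (q * Suc u))"

lemma level_ne [simp]: "Suc m - u \<noteq> Suc (Suc m)"
  by simp

lemma arc_value_snk: "u \<le> m \<Longrightarrow> arc_value c (snk u) = upper c (Suc u) - upper c u"
  by (simp add: arc_value_def snk_def)

lemma arc_value_src: "u < m \<Longrightarrow> arc_value c (src u) = lower c (Suc (q * u)) - lower c (q * u)"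
  by (simp add: arc_value_def src_def Let_def)

lemma arc_value_src_first:
  "arc_value c (src m) = 1 - (\<Sum>u<m. lower c (Suc (q * u)) - lower c (q * u))"
  using m_ge by (simp add: arc_value_def src_def Let_def)

lemma arc_value_fan: "u < m \<Longrightarrow> k < r \<Longrightarrow>
    arc_value c (fan u k) = lower c (Suc (Suc (q * u + k))) - lower c (Suc (q * u + k))"
  by (simp add: arc_value_def fan_def Let_def)

lemma arc_value_path: "u < m \<Longrightarrow> arc_value c (path_arc u) = upper c (Suc u) - lower c (q * Suc u)"
  by (auto simp: arc_value_def path_arc_def Let_def)

lemmas arc_value_simps =
  arc_value_snk arc_value_src arc_value_src_first arc_value_fan arc_value_path

lemma sum_fan_arc_value:
  assumes "u < m"
  shows "(\<Sum>k<r. arc_value c (fan u k)) = lower c (q * Suc u) - lower c (Suc (q * u))"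
proof -
  have "(\<Sum>k<r. arc_value c (fan u k)) =
      (\<Sum>k<r. lower c (Suc (q * u + Suc k)) - lower c (Suc (q * u + k)))"
    using assms by (intro sum.cong) (simp_all add: arc_value_fan)
  also have "\<dots> = lower c (Suc (q * u + r)) - lower c (Suc (q * u + 0))"
    by (rule sum_lessThan_telescope)
  finally show ?thesis by (simp add: q_def ac_simps)
qed

text \<open>
  All the flow equations are telescoping sums.
\<close>

lemma is_flow_arc_value: "is_flow (arc_value c)"
  unfolding is_flow_def
proof (intro conjI allI impI)
  show "(\<Sum>u\<le>m. arc_value c (src u)) = 1"
    unfolding lessThan_Suc_atMost[symmetric] sum.lessThan_Suc
    by (simp add: arc_value_src arc_value_src_first)
  show "(\<Sum>u\<le>m. arc_value c (snk u)) = 1"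
  proof -
    have "(\<Sum>u\<le>m. arc_value c (snk u)) = (\<Sum>u<Suc m. upper c (Suc u) - upper c u)"
      unfolding lessThan_Suc_atMost by (intro sum.cong) (simp_all add: arc_value_snk)
    also have "\<dots> = upper c (Suc m) - upper c 0" by (rule sum_lessThan_telescope)
    finally show ?thesis by (simp add: upper_def)
  qed
  have "(\<Sum>u<m. lower c (q * Suc u) - lower c (q * u)) = lower c (q * m) - lower c (q * 0)"
    by (rule sum_lessThan_telescope)
  moreover have "(\<Sum>u<m. \<Sum>k<r. arc_value c (fan u k)) =
      (\<Sum>u<m. lower c (q * Suc u) - lower c (Suc (q * u)))"
    by (intro sum.cong) (simp_all add: sum_fan_arc_value del: mult_Suc_right)
  moreover have "upper c (Suc m) = 1" "q * Suc (m - 1) = q * m" "Suc (m - 1) = m" "lower c 0 = 0"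
    using m_ge by (auto simp: upper_def lower_def)
  ultimately show "arc_value c (src m) = arc_value c (snk m) + arc_value c (path_arc (m - 1)) +
      (\<Sum>u<m. \<Sum>k<r. arc_value c (fan u k))"
    using m_ge by (simp add: arc_value_src_first arc_value_snk arc_value_path sum_subtractf
        del: mult_Suc_right)
  fix u assume u: "u < m"
  show "arc_value c (src u) + arc_value c (path_arc u) + (\<Sum>k<r. arc_value c (fan u k)) =
      arc_value c (snk u) + (if u = 0 then 0 else arc_value c (path_arc (u - 1)))"
  proof (cases u)
    case 0
    then show ?thesis
      unfolding sum_fan_arc_value[OF u] using u by (simp add: arc_value_simps lower_def upper_def)
  next
    case (Suc u')
    then show ?thesis
      unfolding sum_fan_arc_value[OF u] using u by (simp add: arc_value_simps del: mult_Suc_right)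
  qed
qed

text \<open>
  The order in which the amounts entering the levels are summed: for each level first the arc from the
  source, then the \<open>r\<close> arcs of the fan.
\<close>

definition step :: "nat \<Rightarrow> (nat \<times> nat) \<times> nat" where
  "step l = (if l mod q = 0 then src (l div q) else fan (l div q) (l mod q - 1))"

lemma step_src: "step (q * u) = src u"
  using q_pos by (simp add: step_def)

lemma step_fan: "k < r \<Longrightarrow> step (Suc (q * u + k)) = fan u k"
proof -
  assume "k < r"
  then have "Suc k < q" by (simp add: q_def)
  then have "(q * u + Suc k) mod q = Suc k" "(q * u + Suc k) div q = u"
    by (simp_all del: add_Suc_right)
  then show ?thesis by (simp add: step_def)
qed

lemma step_cases:
  assumes "l < q * m"
  obtains u where "u < m" "l = q * u" | u k where "u < m" "k < r" "l = Suc (q * u + k)"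
proof -
  have u: "l div q < m" using assms by (simp add: less_mult_imp_div_less mult.commute)
  have l: "l = q * (l div q) + l mod q" by simp
  show thesis
  proof (cases "l mod q")
    case 0
    then show thesis using that(1)[of "l div q"] u l by simp
  next
    case (Suc k)
    then have "k < r" using mod_less_divisor[of q l] by (simp add: q_def)
    then show thesis using that(2)[of "l div q" k] u l Suc by simp
  qed
qed

lemma arc_value_step: "l < q * m \<Longrightarrow> arc_value c (step l) = lower c (Suc l) - lower c l"
  by (erule step_cases) (simp_all add: step_src step_fan arc_value_simps)

definition coord :: "((nat \<times> nat) \<times> nat \<Rightarrow> real) \<Rightarrow> nat \<Rightarrow> real" where
  "coord g i = (if i < q * m then \<Sum>l<Suc i. g (step l) else \<Sum>u<Suc (i - q * m). g (snk u))"

lemma coord_arc_value: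
  assumes "i < q * m + m"
  shows "coord (arc_value c) i = c i"
proof (cases "i < q * m")
  case True
  have "(\<Sum>l<Suc i. arc_value c (step l)) = (\<Sum>l<Suc i. lower c (Suc l) - lower c l)"
    using True by (intro sum.cong) (simp_all add: arc_value_step)
  also have "\<dots> = lower c (Suc i) - lower c 0" by (rule sum_lessThan_telescope)
  finally show ?thesis using True by (simp add: coord_def lower_def)
next
  case False
  have "(\<Sum>u<Suc (i - q * m). arc_value c (snk u)) =
      (\<Sum>u<Suc (i - q * m). upper c (Suc u) - upper c u)"
    using assms by (intro sum.cong) (simp_all add: arc_value_snk)
  also have "\<dots> = upper c (Suc (i - q * m)) - upper c 0" by (rule sum_lessThan_telescope)
  finally show ?thesis using False assms by (simp add: coord_def upper_def)
qed

lemma lower_coord: "l \<le> q * m \<Longrightarrow> lower (coord g) l = (\<Sum>x<l. g (step x))"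
  by (cases l) (simp_all add: lower_def coord_def)

lemma upper_coord:
  assumes "is_flow g" "j \<le> Suc m"
  shows "upper (coord g) j = (\<Sum>u<j. g (snk u))"
proof (cases "j = Suc m")
  case True
  then show ?thesis
    using assms(1) unfolding is_flow_def by (simp add: upper_def lessThan_Suc_atMost)
next
  case False
  then show ?thesis using assms(2) by (cases j) (simp_all add: upper_def coord_def)
qed

text \<open>
  On arcs from the source, of the fan and to the sink this holds because a difference of consecutive partial
  sums is a summand. The path arcs follow by induction on the level: both sides
  satisfy the balance equations, which determine the flow on one path arc from the flow on the previous one
  and on the remaining arcs.
\<close>

lemma arc_value_coord:
  assumes g: "is_flow g" and e: "e \<in> arcs H"
  shows "arc_value (coord g) e = g e"
proof -
  note av = is_flow_arc_value[of "coord g"]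
  have bound: "Suc (q * u + k) \<le> q * m" if "u < m" "k < q" for u k
  proof -
    have "Suc (q * u + k) \<le> q * Suc u" using that(2) by simp
    also have "\<dots> \<le> q * m" using that(1) by (intro mult_le_mono2) simp
    finally show ?thesis .
  qed
  have src: "arc_value (coord g) (src u) = g (src u)" if "u < m" for u
    using bound[OF that q_pos] that by (simp add: arc_value_src lower_coord step_src)
  have fan: "arc_value (coord g) (fan u k) = g (fan u k)" if "u < m" "k < r" for u k
  proof -
    have "Suc k < q" using that(2) by (simp add: q_def)
    from bound[OF that(1) this] show ?thesis
      using that by (simp add: arc_value_fan lower_coord step_fan)
  qed
  have snk: "arc_value (coord g) (snk u) = g (snk u)" if "u \<le> m" for u
    using that by (simp add: arc_value_snk upper_coord[OF g])
  have path_arc: "arc_value (coord g) (path_arc u) = g (path_arc u)" if "u < m" for u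
    using that
  proof (induction u)
    case 0
    then show ?case
      using av g src[of 0] snk[of 0] fan[of 0] unfolding is_flow_def by (auto dest!: spec[of _ 0])
  next
    case (Suc u)
    have "arc_value (coord g) (src (Suc u)) + arc_value (coord g) (path_arc (Suc u)) +
        (\<Sum>k<r. arc_value (coord g) (fan (Suc u) k)) =
        arc_value (coord g) (snk (Suc u)) + arc_value (coord g) (path_arc u)"
      "g (src (Suc u)) + g (path_arc (Suc u)) + (\<Sum>k<r. g (fan (Suc u) k)) = g (snk (Suc u)) + g (path_arc u)"
      using av g Suc.prems unfolding is_flow_def by (auto dest!: spec[of _ "Suc u"])
    then show ?case using Suc src[of "Suc u"] snk[of "Suc u"] fan[of "Suc u"] by simp
  qed
  have src_first: "arc_value (coord g) (src m) = g (src m)"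
  proof -
    have "(\<Sum>u<m. arc_value (coord g) (src u)) + arc_value (coord g) (src m) = 1"
      "(\<Sum>u<m. g (src u)) + g (src m) = 1"
      using av g unfolding is_flow_def lessThan_Suc_atMost[symmetric] sum.lessThan_Suc by auto
    then show ?thesis by (simp add: src)
  qed
  from e show ?thesis
    by (cases rule: arcs_H_cases) (simp_all only: src src_first snk fan path_arc)
qed

lemma affine_lower: "l \<le> q * m \<Longrightarrow> affine_map (q * m + m) (\<lambda>c. lower c l)"
  by (cases l) (auto simp: lower_def intro!: affine_map_const affine_map_component)

lemma affine_upper: "affine_map (q * m + m) (\<lambda>c. upper c j)"
  by (cases j; cases "j \<le> m") (auto simp: upper_def intro!: affine_map_const affine_map_component)

lemma affine_arc_value:
  assumes "e \<in> arcs H"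
  shows "affine_map (q * m + m) (\<lambda>c. arc_value c e)"
proof -
  have bound: "q * u + k \<le> q * m" if "u < m" "k \<le> q" for u k
  proof -
    have "q * u + k \<le> q * Suc u" using that(2) by simp
    also have "\<dots> \<le> q * m" using that(1) by (intro mult_le_mono2) simp
    finally show ?thesis .
  qed
  have "Suc (q * u) \<le> q * m" "q * u \<le> q * m" if "u < m" for u
    using bound[OF that, of 1] q_pos that by auto
  note this [simp]
  have src: "affine_map (q * m + m) (\<lambda>c. arc_value c (src u))" if "u \<le> m" for u
  proof (cases "u = m")
    case True
    then show ?thesis
      by (auto simp: arc_value_src_first intro!: affine_map_diff affine_map_const affine_map_sum affine_lower)
  next
    case False
    then show ?thesis using that
      by (auto simp: arc_value_src intro!: affine_map_diff affine_lower)
  qed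
  have fan: "affine_map (q * m + m) (\<lambda>c. arc_value c (fan u k))" if "u < m" "k < r" for u k
    using bound[of u "Suc (Suc k)"] that unfolding arc_value_fan[OF that]
    by (intro affine_map_diff affine_lower) (simp_all add: q_def)
  have path_arc: "affine_map (q * m + m) (\<lambda>c. arc_value c (path_arc u))" if "u < m" for u
    using bound[of u q] that unfolding arc_value_path[OF that]
    by (intro affine_map_diff affine_lower affine_upper) (simp add: ac_simps)
  have snk: "affine_map (q * m + m) (\<lambda>c. arc_value c (snk u))" if "u \<le> m" for u
    unfolding arc_value_snk[OF that] by (intro affine_map_diff affine_upper)
  from assms show ?thesis
    by (cases rule: arcs_H_cases) (auto intro: src fan path_arc snk)
qed

section \<open>The flow polytope in partial-sum coordinates\<close>

definition to_flow :: "(nat \<Rightarrow> real) \<Rightarrow> (nat \<times> nat) \<times> nat \<Rightarrow>\<^sub>0 real" where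
  "to_flow c = Abs_poly_mapping (\<lambda>e. if e \<in> arcs H then arc_value c e else 0)"

lemma lookup_to_flow:
  "Poly_Mapping.lookup (to_flow c) e = (if e \<in> arcs H then arc_value c e else 0)"
proof -
  have "finite {e. (if e \<in> arcs H then arc_value c e else 0) \<noteq> 0}"
    by (rule finite_subset[OF _ finite_arcs_H]) auto
  then show ?thesis by (simp add: to_flow_def)
qed

definition base :: "(nat \<times> nat) \<times> nat \<Rightarrow>\<^sub>0 real" where "base = to_flow (\<lambda>_. 0)"
definition dir :: "nat \<Rightarrow> (nat \<times> nat) \<times> nat \<Rightarrow>\<^sub>0 real" where
  "dir i = to_flow (unit_vec i) - base"

lemma to_flow_eq: "to_flow c = base + lin_comb (q * m + m) dir c"
proof (rule poly_mapping_eqI)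
  fix e
  show "Poly_Mapping.lookup (to_flow c) e = Poly_Mapping.lookup (base + lin_comb (q * m + m) dir c) e"
  proof (cases "e \<in> arcs H")
    case True
    have "arc_value c e = arc_value (\<lambda>_. 0) e +
        (\<Sum>i<q * m + m. c i * (arc_value (unit_vec i) e - arc_value (\<lambda>_. 0) e))"
      using affine_arc_value[OF True] unfolding affine_map_def by blast
    then show ?thesis
      using True by (simp add: lookup_add lookup_lin_comb dir_def base_def lookup_minus lookup_to_flow)
  next
    case False
    then show ?thesis
      by (simp add: lookup_add lookup_lin_comb dir_def base_def lookup_minus lookup_to_flow)
  qed
qed

lemma is_flow_cong:
  assumes "\<And>e. e \<in> arcs H \<Longrightarrow> f e = g e"
  shows "is_flow f = is_flow g"
proof -
  have eq: "u \<le> m \<Longrightarrow> f (src u) = g (src u)" "u \<le> m \<Longrightarrow> f (snk u) = g (snk u)"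
    "u < m \<Longrightarrow> k < r \<Longrightarrow> f (fan u k) = g (fan u k)" "u < m \<Longrightarrow> f (path_arc u) = g (path_arc u)" for u k
    using assms arc_mem by auto
  have fan: "(\<Sum>k<r. f (fan u k)) = (\<Sum>k<r. g (fan u k))" if "u < m" for u
    using eq(3)[OF that] by (intro sum.cong) auto
  have sums: "(\<Sum>u\<le>m. f (src u)) = (\<Sum>u\<le>m. g (src u))" "(\<Sum>u\<le>m. f (snk u)) = (\<Sum>u\<le>m. g (snk u))"
    "(\<Sum>u<m. \<Sum>k<r. f (fan u k)) = (\<Sum>u<m. \<Sum>k<r. g (fan u k))"
    by (intro sum.cong; simp add: eq fan)+
  have first: "f (src m) = g (src m)" "f (snk m) = g (snk m)" "f (path_arc (m - 1)) = g (path_arc (m - 1))"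
    using m_ge by (auto intro!: eq)
  have "(f (src u) + f (path_arc u) + (\<Sum>k<r. f (fan u k)) =
      f (snk u) + (if u = 0 then 0 else f (path_arc (u - 1)))) \<longleftrightarrow>
    (g (src u) + g (path_arc u) + (\<Sum>k<r. g (fan u k)) =
      g (snk u) + (if u = 0 then 0 else g (path_arc (u - 1))))" if "u < m" for u
    using that by (simp add: eq fan)
  then show ?thesis unfolding is_flow_def sums first by blast
qed

lemma flow_polytope_to_flow:
  "flow_polytope H = {f \<in> range (\<lambda>c. base + lin_comb (q * m + m) dir c).
    \<forall>e\<in>arcs H. 0 \<le> Poly_Mapping.lookup f e}"
proof -
  have "Poly_Mapping.keys f \<subseteq> arcs H \<and> is_flow (Poly_Mapping.lookup f) \<longleftrightarrow> f \<in> range to_flow" for f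
  proof
    assume f: "Poly_Mapping.keys f \<subseteq> arcs H \<and> is_flow (Poly_Mapping.lookup f)"
    have "f = to_flow (coord (Poly_Mapping.lookup f))"
    proof (rule poly_mapping_eqI)
      fix e
      show "Poly_Mapping.lookup f e = Poly_Mapping.lookup (to_flow (coord (Poly_Mapping.lookup f))) e"
        using f arc_value_coord[of "Poly_Mapping.lookup f" e] in_keys_iff[of e f]
        by (cases "e \<in> arcs H") (auto simp: lookup_to_flow)
    qed
    then show "f \<in> range to_flow" by blast
  next
    assume "f \<in> range to_flow"
    then obtain c where f: "f = to_flow c" by blast
    have "is_flow (Poly_Mapping.lookup f) = is_flow (arc_value c)"
      by (rule is_flow_cong) (simp add: f lookup_to_flow)
    moreover have "Poly_Mapping.keys f \<subseteq> arcs H"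
      by (auto simp: f in_keys_iff lookup_to_flow split: if_splits)
    ultimately show "Poly_Mapping.keys f \<subseteq> arcs H \<and> is_flow (Poly_Mapping.lookup f)"
      using is_flow_arc_value by simp
  qed
  then show ?thesis unfolding flow_polytope_H to_flow_eq[abs_def, symmetric] by blast
qed

lemma step_mem: "l < q * m \<Longrightarrow> step l \<in> arcs H"
  by (erule step_cases) (simp_all add: step_src step_fan arc_mem)

text \<open>
  The inequalities between neighbouring partial sums are nonnegativity of the flow on single arcs. The
  arc from the source to vertex 1 adds no inequality, since its flow is the sum of the flows
  leaving vertex 1.
\<close>

lemma arc_value_nonneg_iff:
  "(\<forall>e\<in>arcs H. 0 \<le> arc_value c e) \<longleftrightarrow> two_chains q (q * m) (q * m) m 1 c"
proof
  assume nonneg: "\<forall>e\<in>arcs H. 0 \<le> arc_value c e"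
  have lower_Suc: "lower c l \<le> lower c (Suc l)" if "l < q * m" for l
    using nonneg step_mem[OF that] arc_value_step[OF that, of c] by force
  have upper_Suc: "upper c u \<le> upper c (Suc u)" if "u \<le> m" for u
    using nonneg arc_mem(2)[OF that] arc_value_snk[OF that, of c] by force
  have cross: "lower c (q * Suc u) \<le> upper c (Suc u)" if "u < m" for u
    using nonneg arc_mem(4)[OF that] arc_value_path[OF that, of c] by force
  have lower_mono: "lower c l \<le> lower c l'" if "l \<le> l'" "l' \<le> q * m" for l l'
    using that by (induction l' rule: dec_induct) (auto intro: order_trans[OF _ lower_Suc])
  have upper_mono: "upper c u \<le> upper c u'" if "u \<le> u'" "u' \<le> Suc m" for u u'
    using that by (induction u' rule: dec_induct) (auto intro: order_trans[OF _ upper_Suc])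
  have c_lower: "c l = lower c (Suc l)" for l by (simp add: lower_def)
  have c_upper: "c (q * m + u) = upper c (Suc u)" if "u < m" for u using that by (simp add: upper_def)
  have lower_0: "lower c 0 = 0" and upper_0: "upper c 0 = 0" and upper_m: "upper c (Suc m) = 1"
    by (simp_all add: lower_def upper_def)
  have top: "lower c (q * m) \<le> 1"
    using cross[of "m - 1"] upper_Suc[of m] m_ge upper_m by simp
  show "two_chains q (q * m) (q * m) m 1 c"
    unfolding two_chains_def
  proof (intro conjI allI impI)
    fix l assume l: "l < q * m"
    show "0 \<le> c l" using lower_mono[of 0 "Suc l"] l by (simp add: c_lower lower_0)
    show "c l \<le> 1" using lower_mono[of "Suc l" "q * m"] l top by (simp add: c_lower)
    fix l' assume "l' < l"
    then show "c l' \<le> c l" using lower_mono[of "Suc l'" "Suc l"] l by (simp add: c_lower)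
  next
    fix u assume u: "u < m"
    show "0 \<le> c (q * m + u)" using upper_mono[of 0 "Suc u"] u by (simp add: c_upper upper_0)
    show "c (q * m + u) \<le> 1" using upper_mono[of "Suc u" "Suc m"] u by (simp add: c_upper upper_m)
    fix u' assume "u' < u"
    then show "c (q * m + u') \<le> c (q * m + u)"
      using upper_mono[of "Suc u'" "Suc u"] u by (simp add: c_upper)
  next
    fix u l assume u: "u < m" and l: "l < q * (u + 1)"
    have "q * Suc u \<le> q * m" using u by (intro mult_le_mono2) simp
    then have "lower c (Suc l) \<le> lower c (q * Suc u)" using l by (intro lower_mono) auto
    then show "c l \<le> c (q * m + u)"
      unfolding c_lower[of l] c_upper[OF u] by (rule order_trans[OF _ cross[OF u]])
  qed
next
  assume tc: "two_chains q (q * m) (q * m) m 1 c"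
  have lower_Suc: "lower c l \<le> lower c (Suc l)" if "l < q * m" for l
    using tc that unfolding two_chains_def by (cases l) (auto simp: lower_def)
  have upper_Suc: "upper c u \<le> upper c (Suc u)" if "u \<le> m" for u
  proof (cases u)
    case 0
    have "0 < m" using m_ge by simp
    then have "0 \<le> c (q * m + 0)" using tc unfolding two_chains_def by blast
    then show ?thesis using 0 m_ge by (simp add: upper_def)
  next
    case (Suc u')
    have "c (q * m + u') \<le> (if Suc u' < m then c (q * m + Suc u') else 1)"
      using tc that Suc unfolding two_chains_def by (metis Suc_le_lessD lessI)
    then show ?thesis using that Suc by (auto simp: upper_def)
  qed
  have cross: "lower c (q * Suc u) \<le> upper c (Suc u)" if "u < m" for u
  proof -
    \<comment> \<open>The partial sum \<open>s_l\<close> is the component with index \<open>l - 1\<close>.\<close>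
    have "q * Suc u - 1 < q * (u + 1)" using q_pos by simp
    then have "c (q * Suc u - 1) \<le> c (q * m + u)" using tc that unfolding two_chains_def by blast
    then show ?thesis using that q_pos by (simp add: lower_def upper_def)
  qed
  have src: "0 \<le> arc_value c (src u)" if "u < m" for u
    using that lower_Suc[of "q * u"] q_pos by (simp add: arc_value_src)
  have snk: "0 \<le> arc_value c (snk u)" if "u \<le> m" for u
    using upper_Suc[OF that] by (simp add: arc_value_snk[OF that])
  have path_arc: "0 \<le> arc_value c (path_arc u)" if "u < m" for u
    using cross[OF that] by (simp add: arc_value_path[OF that])
  have fan: "0 \<le> arc_value c (fan u k)" if "u < m" "k < r" for u k
  proof -
    have "Suc (q * u + k) < q * Suc u" using that(2) by (simp add: q_def)
    also have "\<dots> \<le> q * m" using that(1) by (intro mult_le_mono2) simp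
    finally show ?thesis using lower_Suc by (simp add: arc_value_fan[OF that])
  qed
  have src_first: "0 \<le> arc_value c (src m)"
  proof -
    have "arc_value c (src m) = arc_value c (snk m) + arc_value c (path_arc (m - 1)) +
        (\<Sum>u<m. \<Sum>k<r. arc_value c (fan u k))"
      using is_flow_arc_value[of c] unfolding is_flow_def by blast
    also have "\<dots> \<ge> 0"
      using m_ge by (intro add_nonneg_nonneg sum_nonneg snk path_arc fan) auto
    finally show ?thesis .
  qed
  show "\<forall>e\<in>arcs H. 0 \<le> arc_value c e"
  proof
    fix e assume "e \<in> arcs H"
    then show "0 \<le> arc_value c e"
      by (cases rule: arcs_H_cases) (simp_all only: src src_first snk path_arc fan)
  qed
qed

text \<open>
  Equally spaced values put every index strictly below every later one, and the
  last one strictly below 1, so no inequality is tight.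
\<close>

lemma arc_value_positive:
  assumes "e \<in> arcs H"
  shows "0 < arc_value (\<lambda>i. (real i + 1) / (real (q * m + m) + 1)) e"
proof -
  define D where "D = real (q * m + m) + 1"
  define c where "c = (\<lambda>i. (real i + 1) / D)"
  have D: "D > 0" unfolding D_def by (rule add_nonneg_pos[OF of_nat_0_le_iff zero_less_one])
  have lower: "lower c l = real l / D" for l
    by (cases l) (simp_all add: lower_def c_def)
  have upper: "upper c (Suc j) = real (q * m + Suc j) / D" if "j \<le> m" for j
    using that D by (auto simp: upper_def c_def le_Suc_eq) (simp add: D_def)
  have upper_Suc: "upper c u < upper c (Suc u)" if "u \<le> m" for u
  proof (cases u)
    case 0
    have "0 < real (q * m + Suc 0) / D"
      by (rule divide_pos_pos[OF of_nat_0_less_iff[THEN iffD2] D]) simp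
    then show ?thesis unfolding 0 upper[OF le0] by (simp add: upper_def)
  next
    case (Suc u')
    then show ?thesis using that D by (simp add: upper divide_strict_right_mono)
  qed
  have lower_Suc: "lower c l < lower c (Suc l)" for l
    unfolding lower using D by (intro divide_strict_right_mono) auto
  have cross: "lower c (q * Suc u) < upper c (Suc u)" if "u < m" for u
  proof -
    have "q * Suc u \<le> q * m" using that by (intro mult_le_mono2) simp
    then have "real (q * Suc u) < real (q * m + Suc u)" by (intro of_nat_less_iff[THEN iffD2]) simp
    then show ?thesis
      unfolding lower using that D by (subst upper) (auto intro: divide_strict_right_mono)
  qed
  have src: "0 < arc_value c (src u)" if "u < m" for u
    using lower_Suc[of "q * u"] by (simp add: arc_value_src[OF that])
  have snk: "0 < arc_value c (snk u)" if "u \<le> m" for u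
    using upper_Suc[OF that] by (simp add: arc_value_snk[OF that])
  have path_arc: "0 < arc_value c (path_arc u)" if "u < m" for u
    using cross[OF that] by (simp add: arc_value_path[OF that])
  have fan: "0 < arc_value c (fan u k)" if "u < m" "k < r" for u k
    using lower_Suc by (simp add: arc_value_fan[OF that])
  have src_first: "0 < arc_value c (src m)"
  proof -
    have "arc_value c (src m) = arc_value c (snk m) + arc_value c (path_arc (m - 1)) +
        (\<Sum>u<m. \<Sum>k<r. arc_value c (fan u k))"
      using is_flow_arc_value[of c] unfolding is_flow_def by blast
    also have "\<dots> > 0"
      using m_ge by (intro add_pos_nonneg add_pos_pos sum_nonneg snk path_arc less_imp_le[OF fan]) auto
    finally show ?thesis .
  qed
  from assms show ?thesis
    unfolding D_def[symmetric] c_def[symmetric]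
    by (cases rule: arcs_H_cases) (simp_all only: src src_first snk path_arc fan)
qed

lemma affine_hull_flow_polytope:
  "affine hull (flow_polytope H) = range (\<lambda>c. base + lin_comb (q * m + m) dir c)"
  by (rule affine_hull_positive_part[OF flow_polytope_to_flow finite_arcs_H])
    (use arc_value_positive in \<open>simp add: to_flow_eq[symmetric] lookup_to_flow\<close>)

lemma lattice_frame_flow_polytope: "is_lattice_frame (flow_polytope H) (q * m + m, base, dir)"
proof (rule is_lattice_frameI[where \<Psi> = "\<lambda>f. coord (Poly_Mapping.lookup f)"])
  show "affine hull flow_polytope H = range (\<lambda>c. base + lin_comb (q * m + m) dir c)"
    by (rule affine_hull_flow_polytope)
next
  fix c i assume i: "i < q * m + m"
  have "coord (Poly_Mapping.lookup (to_flow c)) i = coord (arc_value c) i"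
  proof (cases "i < q * m")
    case True
    have "(\<Sum>l<Suc i. Poly_Mapping.lookup (to_flow c) (step l)) = (\<Sum>l<Suc i. arc_value c (step l))"
      using True by (intro sum.cong) (auto simp: lookup_to_flow step_mem)
    then show ?thesis using True by (simp add: coord_def)
  next
    case False
    have "(\<Sum>u<Suc (i - q * m). Poly_Mapping.lookup (to_flow c) (snk u)) =
        (\<Sum>u<Suc (i - q * m). arc_value c (snk u))"
      using i by (intro sum.cong) (auto simp: lookup_to_flow arc_mem)
    then show ?thesis using False by (simp add: coord_def)
  qed
  then show "coord (Poly_Mapping.lookup (base + lin_comb (q * m + m) dir c)) i = c i"
    by (simp add: to_flow_eq[symmetric] coord_arc_value i)
next
  fix c :: "nat \<Rightarrow> int"
  have "lower (\<lambda>i. of_int (c i)) l \<in> \<int>" "upper (\<lambda>i. of_int (c i)) l \<in> \<int>" for l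
    by (auto simp: lower_def upper_def)
  then have "arc_value (\<lambda>i. of_int (c i)) e \<in> \<int>" for e
    by (auto simp: arc_value_def Let_def split: prod.split)
  then show "base + lin_comb (q * m + m) dir (\<lambda>i. of_int (c i)) \<in> integer_points"
    by (simp add: to_flow_eq[symmetric] integer_points_def lookup_to_flow)
next
  fix x :: "(nat \<times> nat) \<times> nat \<Rightarrow>\<^sub>0 real" and i
  assume "x \<in> integer_points"
  then have "Poly_Mapping.lookup x e \<in> \<int>" for e unfolding integer_points_def by blast
  then have "(\<Sum>l<k. Poly_Mapping.lookup x (h l)) \<in> \<int>" for k and h :: "nat \<Rightarrow> _"
    by (intro Ints_sum)
  then show "coord (Poly_Mapping.lookup x) i \<in> \<int>"
    by (simp only: coord_def split: if_split) blast
qed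

lemma flow_polytope_coordinates:
  "{c \<in> {..<q * m + m} \<rightarrow>\<^sub>E UNIV. base + lin_comb (q * m + m) dir c \<in> flow_polytope H} =
    two_chain_region q (q * m) (q * m) m 1"
proof -
  have "base + lin_comb (q * m + m) dir c \<in> flow_polytope H \<longleftrightarrow>
      two_chains q (q * m) (q * m) m 1 c" for c
    unfolding arc_value_nonneg_iff[symmetric] flow_polytope_to_flow to_flow_eq[symmetric]
    by (auto simp: lookup_to_flow)
  moreover have "chain_index (q * m) (q * m) m = {..<q * m + m}"
    by (auto simp: chain_index_def)
  ultimately show ?thesis
    by (auto simp: two_chain_region_def space_PiM)
qed

theorem normalized_volume_flow_polytope:
  "normalized_volume (flow_polytope H) =
    1 / real (q * m + 1) * real ((q * m + m) choose m)"
proof -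
  let ?R = "two_chain_region q (q * m) (q * m) m 1" and ?d = "q * m + m"
  have index: "chain_index (q * m) (q * m) m = {..<?d}"
    by (auto simp: chain_index_def)
  have "?R \<in> sets (lborel_pow ?d)"
    using sets_two_chain_region[of q m "q * m" "q * m" 1] by (simp add: index)
  then have "normalized_volume (flow_polytope H) = fact ?d * measure (lborel_pow ?d) ?R"
    using normalized_volume_eq[OF lattice_frame_flow_polytope] by (simp add: flow_polytope_coordinates)
  also have "measure (lborel_pow ?d) ?R = 1 / (fact (Suc (q * m)) * fact m)"
    using emeasure_two_chain_region[of q "q * m" "q * m" m 1] q_pos
    by (simp add: index measure_def del: fact_Suc)
  also have "fact ?d * (1 / (fact (Suc (q * m)) * fact m)) =
      1 / real (q * m + 1) * real (?d choose m)"
    by (simp add: binomial_fact)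
  finally show ?thesis .
qed

end

theorem corollary16:
  fixes n r :: nat
  assumes "n \<ge> 1"
  shows "normalized_volume (flow_polytope (tilde_graph (n + 2) (G_edges n r))) =
    1 / real ((r + 1) * (n + 1) + 1) * real (((r + 2) * (n + 1)) choose (n + 1))"
proof -
  interpret fan_path_network "n + 1" r
    by standard (use assms in simp)
  have "H = tilde_graph (n + 2) (G_edges n r)" unfolding H_def by simp
  moreover have "q * (n + 1) + (n + 1) = (r + 2) * (n + 1)" "q = r + 1" by (simp_all add: q_def)
  ultimately show ?thesis using normalized_volume_flow_polytope by metis
qed

end
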